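(* Let $M$ be a Lie monoid with a normal boundary and let $X$ be a left-invariant vector field on $M$. Then: (i) Suppose either that $e\in\operatorname{Int}M$, or that $e\in\partial M$ and $X_e$ is tangent to $\partial M$. Then $X|_{\partial M}$ is tangent to $\partial M$, and $X$ is complete. (ii) Suppose $e\in\partial M$ and $X_e$ is either inward-pointing or outward-pointing. Then $J^X_e=[0,\infty)$ or $J^X_e=(-\infty,0]$, respectively, and $X$ is half-complete. Moreover, the flow of $X$ is given for all $t\in J^X_e$ by $\phi^X_t=R_{\phi^X_t(e)}$.
   Context: A Lie monoid is a monoid $M$ with unit $e$ together with a structure of a smooth manifold with or without boundary such that multiplication $M\times M\to M$ is smooth. $L_g(h)=gh$ and $R_g(h)=hg$ denote left and right translations. $M$ has a normal boundary if either $e\in\operatorname{Int}M$, or $\partial M$ is a submonoid of $M$ (so closed under multiplication and $e\in\partial M$). A vector field $X$ on $M$ is left-invariant if $d(L_g)_h(X_h)=X_{gh}$ for all $g,h\in M$. $J^X_g$ is the maximal interval on which the integral path $\gamma^X_g$ of $X$ starting at $g$ is defined, and $\phi^X_t(g)=\gamma^X_g(t)$. $X$ is complete if $J^X_g=\mathbb R$ for all $g$, and half-complete if for each $g\in M$ either $[0,\infty)\subset J^X_g$ or $(-\infty,0]\subset J^X_g$. *)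

theory Defs
  imports "HOL-Analysis.Analysis"
begin

section \<open>Smooth maps between subsets of Euclidean spaces\<close>

primrec Ck_on :: "nat \<Rightarrow> ('a::euclidean_space \<Rightarrow> 'b::euclidean_space) \<Rightarrow> 'a set \<Rightarrow> bool" where
  "Ck_on 0 f U \<longleftrightarrow> continuous_on U f"
| "Ck_on (Suc k) f U \<longleftrightarrow>
     (\<forall>x\<in>U. f differentiable (at x)) \<and>
     (\<forall>v. Ck_on k (\<lambda>x. frechet_derivative f (at x) v) U)"

text \<open>On an arbitrary set \<open>S\<close>, smoothness means that there are local smooth extensions to open sets.\<close>

definition smooth_on :: "'a::euclidean_space set \<Rightarrow> ('a \<Rightarrow> 'b::euclidean_space) \<Rightarrow> bool" where
  "smooth_on S f \<longleftrightarrow>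
     (\<forall>x\<in>S. \<exists>U F. open U \<and> x \<in> U \<and> (\<forall>k. Ck_on k F U) \<and> (\<forall>y\<in>S \<inter> U. F y = f y))"


section \<open>Smooth manifolds with or without boundary\<close>

text \<open>
  Charts take values in a model space \<open>H\<close>. In dimension \<open>n \<ge> 1\<close> this is a closed coordinate
  half-space of a Euclidean space of dimension \<open>n\<close>; a manifold without boundary has an atlas
  with values in the interior of \<open>H\<close>. Types of class \<^class>\<open>euclidean_space\<close> have positive
  dimension, so dimension \<open>0\<close> is covered by the model \<open>{0}\<close>. The relative notions
  treat both cases uniformly: \<open>span H\<close> is the space \<open>\<real>\<^sup>n\<close>, \<open>rel_interior H\<close> is the half-space
  \<open>x \<bullet> b > 0\<close> (respectively \<open>{0}\<close>), and \<open>rel_frontier H\<close> is the hyperplane \<open>x \<bullet> b = 0\<close>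
  (respectively empty).
\<close>

definition model_space :: "'e::euclidean_space set \<Rightarrow> bool" where
  "model_space H \<longleftrightarrow> H = {0} \<or> (\<exists>b\<in>Basis. H = {x. 0 \<le> x \<bullet> b})"

type_synonym ('m, 'e) chart = "'m set \<times> ('m \<Rightarrow> 'e)"

definition chart_on :: "'e::euclidean_space set \<Rightarrow> ('m::topological_space, 'e) chart \<Rightarrow> bool" where
  "chart_on H = (\<lambda>(U, \<phi>). open U \<and> openin (top_of_set H) (\<phi> ` U) \<and>
     homeomorphism U (\<phi> ` U) \<phi> (inv_into U \<phi>))"

text \<open>The coordinate representation of \<open>f\<close> with respect to two charts, and its domain.\<close>

fun coord_rep :: "('m, 'd) chart \<Rightarrow> ('n, 'e) chart \<Rightarrow> ('m \<Rightarrow> 'n) \<Rightarrow> 'd \<Rightarrow> 'e" where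
  "coord_rep (U, \<phi>) (V, \<psi>) f = \<psi> \<circ> f \<circ> inv_into U \<phi>"

fun coord_dom :: "('m, 'd) chart \<Rightarrow> ('n, 'e) chart \<Rightarrow> ('m \<Rightarrow> 'n) \<Rightarrow> 'd set" where
  "coord_dom (U, \<phi>) (V, \<psi>) f = \<phi> ` (U \<inter> f -` V)"

definition smooth_manifold ::
  "'e::euclidean_space set \<Rightarrow> ('m::{t2_space, second_countable_topology}, 'e) chart set \<Rightarrow> bool" where
  "smooth_manifold H A \<longleftrightarrow>
     model_space H \<and>
     (\<forall>c\<in>A. chart_on H c) \<and>
     (\<Union>c\<in>A. fst c) = UNIV \<and>
     (\<forall>c\<in>A. \<forall>d\<in>A. smooth_on (coord_dom c d id) (coord_rep c d id))"

definition interior_points :: "'e::euclidean_space set \<Rightarrow> ('m, 'e) chart set \<Rightarrow> 'm set" where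
  "interior_points H A = {p. \<exists>(U, \<phi>)\<in>A. p \<in> U \<and> \<phi> p \<in> rel_interior H}"

definition boundary_points :: "'e::euclidean_space set \<Rightarrow> ('m, 'e) chart set \<Rightarrow> 'm set" where
  "boundary_points H A = {p. \<exists>(U, \<phi>)\<in>A. p \<in> U \<and> \<phi> p \<in> rel_frontier H}"

text \<open>
  Below, \<open>A\<close> may also be a product atlas, whose charts take values in \<open>H \<times> H\<close>; this is
  how smoothness of maps on the product of two manifolds with boundary is understood.
\<close>

definition smooth_map ::
  "('m::topological_space, 'd::euclidean_space) chart set \<Rightarrow>
   ('n::topological_space, 'e::euclidean_space) chart set \<Rightarrow> ('m \<Rightarrow> 'n) \<Rightarrow> bool" where
  "smooth_map A B f \<longleftrightarrow>
     continuous_on UNIV f \<and> (\<forall>c\<in>A. \<forall>d\<in>B. smooth_on (coord_dom c d f) (coord_rep c d f))"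

definition prod_atlas ::
  "('m, 'd) chart set \<Rightarrow> ('n, 'e) chart set \<Rightarrow> ('m \<times> 'n, 'd \<times> 'e) chart set" where
  "prod_atlas A B = {(U \<times> V, map_prod \<phi> \<psi>) | U V \<phi> \<psi>. (U, \<phi>) \<in> A \<and> (V, \<psi>) \<in> B}"


section \<open>Tangent vectors, differentials and vector fields\<close>

text \<open>
  A tangent vector at \<open>p\<close> is given by its components with respect to the charts around \<open>p\<close>,
  which are related by the derivatives of the transition maps; it is set to \<open>0\<close> on
  all other arguments, so that equality of tangent vectors is equality of functions.
\<close>

type_synonym ('m, 'e) tvec = "('m, 'e) chart \<Rightarrow> 'e"

definition charts_at :: "('m, 'e) chart set \<Rightarrow> 'm \<Rightarrow> ('m, 'e) chart set" where
  "charts_at A p = {c \<in> A. p \<in> fst c}"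

definition tangent_space ::
  "'e::euclidean_space set \<Rightarrow> ('m, 'e) chart set \<Rightarrow> 'm \<Rightarrow> ('m, 'e) tvec set" where
  "tangent_space H A p =
     {v. (\<forall>c\<in>charts_at A p. v c \<in> span H) \<and>
         (\<forall>c. c \<notin> charts_at A p \<longrightarrow> v c = 0) \<and>
         (\<forall>c\<in>charts_at A p. \<forall>d\<in>charts_at A p.
            v d = frechet_derivative (coord_rep c d id)
                    (at (snd c p) within coord_dom c d id) (v c))}"

text \<open>
  The differential of \<open>f\<close> at \<open>p\<close>, computed in some chart around \<open>p\<close>; by the chain
  rule the choice does not matter for tangent vectors and smooth \<open>f\<close>.
\<close>

definition differential ::
  "('m, 'd::euclidean_space) chart set \<Rightarrow> ('n, 'e::euclidean_space) chart set \<Rightarrow>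
   ('m \<Rightarrow> 'n) \<Rightarrow> 'm \<Rightarrow> ('m, 'd) tvec \<Rightarrow> ('n, 'e) tvec" where
  "differential A B f p v =
     (let c = (SOME c. c \<in> charts_at A p) in
      (\<lambda>d. if d \<in> charts_at B (f p)
           then frechet_derivative (coord_rep c d f) (at (snd c p) within coord_dom c d f) (v c)
           else 0))"

definition vector_field ::
  "'e::euclidean_space set \<Rightarrow> ('m, 'e) chart set \<Rightarrow> ('m \<Rightarrow> ('m, 'e) tvec) \<Rightarrow> bool" where
  "vector_field H A X \<longleftrightarrow>
     (\<forall>p. X p \<in> tangent_space H A p) \<and>
     (\<forall>(U, \<phi>)\<in>A. smooth_on (\<phi> ` U) (\<lambda>x. X (inv_into U \<phi> x) (U, \<phi>)))"

text \<open>
  A chart around a boundary point \<open>p\<close> restricts to a chart of \<open>\<partial>M\<close> with values in the linear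
  hyperplane \<open>rel_frontier H\<close>, so the latter consists of the components of the vectors in \<open>T\<^sub>p\<partial>M\<close>.
\<close>

definition tangent_to_boundary ::
  "'e::euclidean_space set \<Rightarrow> ('m, 'e) chart set \<Rightarrow> 'm \<Rightarrow> ('m, 'e) tvec \<Rightarrow> bool" where
  "tangent_to_boundary H A p v \<longleftrightarrow>
     p \<in> boundary_points H A \<and> (\<forall>c\<in>charts_at A p. v c \<in> rel_frontier H)"

definition inward_pointing ::
  "'e::euclidean_space set \<Rightarrow> ('m, 'e) chart set \<Rightarrow> 'm \<Rightarrow> ('m, 'e) tvec \<Rightarrow> bool" where
  "inward_pointing H A p v \<longleftrightarrow>
     p \<in> boundary_points H A \<and> (\<forall>c\<in>charts_at A p. v c \<in> rel_interior H)"

definition outward_pointing ::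
  "'e::euclidean_space set \<Rightarrow> ('m, 'e) chart set \<Rightarrow> 'm \<Rightarrow> ('m, 'e) tvec \<Rightarrow> bool" where
  "outward_pointing H A p v \<longleftrightarrow>
     p \<in> boundary_points H A \<and> (\<forall>c\<in>charts_at A p. - v c \<in> rel_interior H)"


section \<open>Integral paths and the flow\<close>

text \<open>
  The interval \<open>I\<close> may contain its end points (the derivative is then one-sided), and
  \<open>I = {0}\<close> is allowed: at a boundary point there need not be any longer integral path.
\<close>

definition integral_path_on ::
  "('m::topological_space, 'e::euclidean_space) chart set \<Rightarrow> ('m \<Rightarrow> ('m, 'e) tvec) \<Rightarrow>
   'm \<Rightarrow> real set \<Rightarrow> (real \<Rightarrow> 'm) \<Rightarrow> bool" where
  "integral_path_on A X g I \<gamma> \<longleftrightarrow>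
     is_interval I \<and> 0 \<in> I \<and> \<gamma> 0 = g \<and> continuous_on I \<gamma> \<and>
     (\<forall>t\<in>I. \<forall>c\<in>charts_at A (\<gamma> t).
        ((snd c \<circ> \<gamma>) has_vector_derivative X (\<gamma> t) c) (at t within I))"

text \<open>Integral paths starting at \<open>g\<close> agree on the intersection of their domains, so the following
  is the domain of the maximal one, and the description of its values is definite.\<close>

definition path_domain ::
  "('m::topological_space, 'e::euclidean_space) chart set \<Rightarrow> ('m \<Rightarrow> ('m, 'e) tvec) \<Rightarrow>
   'm \<Rightarrow> real set" where
  "path_domain A X g = \<Union>{I. \<exists>\<gamma>. integral_path_on A X g I \<gamma>}"

definition integral_path ::
  "('m::topological_space, 'e::euclidean_space) chart set \<Rightarrow> ('m \<Rightarrow> ('m, 'e) tvec) \<Rightarrow>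
   'm \<Rightarrow> real \<Rightarrow> 'm" where
  "integral_path A X g t = (THE y. \<exists>I \<gamma>. integral_path_on A X g I \<gamma> \<and> t \<in> I \<and> \<gamma> t = y)"

definition flow ::
  "('m::topological_space, 'e::euclidean_space) chart set \<Rightarrow> ('m \<Rightarrow> ('m, 'e) tvec) \<Rightarrow>
   real \<Rightarrow> 'm \<Rightarrow> 'm" where
  "flow A X t g = integral_path A X g t"

definition complete_field ::
  "('m::topological_space, 'e::euclidean_space) chart set \<Rightarrow> ('m \<Rightarrow> ('m, 'e) tvec) \<Rightarrow> bool" where
  "complete_field A X \<longleftrightarrow> (\<forall>g. path_domain A X g = UNIV)"

definition half_complete_field ::
  "('m::topological_space, 'e::euclidean_space) chart set \<Rightarrow> ('m \<Rightarrow> ('m, 'e) tvec) \<Rightarrow> bool" where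
  "half_complete_field A X \<longleftrightarrow>
     (\<forall>g. {0..} \<subseteq> path_domain A X g \<or> {..0} \<subseteq> path_domain A X g)"


section \<open>Lie monoids\<close>

definition lie_monoid ::
  "'e::euclidean_space set \<Rightarrow>
   ('m::{monoid_mult, t2_space, second_countable_topology}, 'e) chart set \<Rightarrow> bool" where
  "lie_monoid H A \<longleftrightarrow>
     smooth_manifold H A \<and> smooth_map (prod_atlas A A) A (\<lambda>(g, h). g * h)"

definition normal_boundary ::
  "'e::euclidean_space set \<Rightarrow> ('m::monoid_mult, 'e) chart set \<Rightarrow> bool" where
  "normal_boundary H A \<longleftrightarrow>
     1 \<in> interior_points H A \<or>
     (1 \<in> boundary_points H A \<and>
      (\<forall>g\<in>boundary_points H A. \<forall>h\<in>boundary_points H A. g * h \<in> boundary_points H A))"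

definition left_translation :: "'m::monoid_mult \<Rightarrow> 'm \<Rightarrow> 'm" where
  "left_translation g h = g * h"

definition right_translation :: "'m::monoid_mult \<Rightarrow> 'm \<Rightarrow> 'm" where
  "right_translation g h = h * g"

definition left_invariant ::
  "('m::monoid_mult, 'e::euclidean_space) chart set \<Rightarrow> ('m \<Rightarrow> ('m, 'e) tvec) \<Rightarrow> bool" where
  "left_invariant A X \<longleftrightarrow>
     (\<forall>g h. differential A A (left_translation g) h (X h) = X (g * h))"

end

theory Submission
  imports Defs
begin

text \<open>
  Everything follows from one observation: if \<open>\<gamma>\<close> is an integral path of a left-invariant field \<open>X\<close> that starts at
  the unit, then \<open>g * \<gamma>\<close> is an integral path that starts at \<open>g\<close>, with the same domain
  (\<open>integral_path_left_translation\<close>). As integral paths are unique (\<open>integral_path_unique\<close>), this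
  is the formula for the flow. It also shows that all
  points share the life time of the path from the unit. So if the latter exists on some interval \<open>[0, e]\<close>
  with \<open>e > 0\<close>, every path can be prolonged by the fixed amount \<open>e\<close> again and again, hence to
  \<open>[0, \<infinity>)\<close> (\<open>uniform_forward_time_imp_forward_complete\<close>). Negative times are treated by
  passing to \<open>-X\<close> (\<open>integral_path_on_uminus\<close>).

  It remains to decide in which time directions the path from the unit exists at all
  (\<open>forward_path_exists\<close>). At an interior point it exists in both directions, and if \<open>X 1\<close> points
  inwards at the boundary, it exists forwards. If \<open>X 1\<close> is tangent to the boundary, left
  translation by boundary points spreads tangency to the whole boundary, because the
  boundary is a submonoid (\<open>tangent_at_unit_imp_tangent_to_boundary\<close>); then the equation can be solved
  within the boundary in both directions.

  Conversely, a path that starts at a boundary point and can be followed forwards has a velocity with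
  nonnegative normal component (\<open>forward_path_at_boundary_inner_nonneg\<close>). Hence a
  complete field is tangent to the boundary, and for an inward-pointing \<open>X 1\<close> the path from the unit
  cannot be continued to negative times.

  The analytic input consists of the Picard--Lindeloef theorem, proved with Banach's fixed point theorem
  (\<open>picard_local\<close>), local uniqueness of solutions (\<open>ode_unique_local\<close>), and the fact that
  being a boundary point does not depend on the chart (\<open>boundary_in_every_chart\<close>).
\<close>

section \<open>Ordinary differential equations with a Lipschitz right-hand side\<close>

text \<open>
Clamping the upper limit of integration to \<open>[0, e]\<close> turns the Picard operator into a
self-map of the complete space of bounded continuous functions on the whole line, to which
Banach's fixed point theorem applies directly.
\<close>

lemma clamped_integral_bcontfun:
  fixes h :: "real \<Rightarrow> 'a::euclidean_space"
  assumes "continuous_on {0..e} h" "0 \<le> e"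
  shows "(\<lambda>t. x + integral {0..max 0 (min e t)} h) \<in> bcontfun"
proof -
  have c: "continuous_on {0..e} (\<lambda>t. x + integral {0..t} h)"
    by (intro continuous_intros indefinite_integral_continuous_1 integrable_continuous_real assms)
  have "continuous_on UNIV ((\<lambda>t. x + integral {0..t} h) \<circ> (\<lambda>t. max 0 (min e t)))"
    by (intro continuous_on_compose continuous_on_subset[OF c] continuous_intros)
      (use assms in auto)
  moreover have "bounded (range ((\<lambda>t. x + integral {0..t} h) \<circ> (\<lambda>t. max 0 (min e t))))"
    by (rule bounded_subset[OF compact_imp_bounded[OF compact_continuous_image[OF c compact_Icc]]])
      (use assms in auto)
  ultimately show ?thesis by (simp add: bcontfun_def o_def)
qed

text \<open>
The Picard--Lindeloef theorem in the globally Lipschitz case: the Picard operator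
\<open>T y t = x + \<integral>\<^sub>0\<^sup>t G (y s) ds\<close> is a contraction for the supremum norm once the time interval
is short compared with \<open>1 / L\<close>.
\<close>

lemma picard_global:
  fixes G :: "'a::euclidean_space \<Rightarrow> 'a"
  assumes L: "L-lipschitz_on UNIV G"
  shows "\<exists>e>0. \<exists>y. y 0 = x \<and>
    (\<forall>t\<in>{0..e}. (y has_vector_derivative G (y t)) (at t within {0..e}))"
proof -
  \<comment> \<open>\<open>L * e \<le> 1/2\<close> makes the Picard operator a contraction; \<open>L + 1\<close> avoids a division by zero.\<close>
  define e where "e = 1 / (2 * (L + 1))"
  have L0: "0 \<le> L" using L lipschitz_on_nonneg by blast
  then have e: "0 < e" "L * e \<le> 1/2" by (auto simp: e_def field_simps)
  have Gc: "continuous_on S G" for S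
    using L lipschitz_on_continuous_on continuous_on_subset by blast
  define T where "T y = (\<lambda>t. x + integral {0..max 0 (min e t)} (\<lambda>s. G (apply_bcontfun y s)))" for y
  have cont: "continuous_on S (\<lambda>s. G (apply_bcontfun y s))" for S y
    by (intro continuous_on_compose2[OF Gc[of UNIV]] continuous_intros) auto
  have T: "T y \<in> bcontfun" for y
    unfolding T_def by (rule clamped_integral_bcontfun) (use e cont in auto)
  have "dist (Bcontfun (T y)) (Bcontfun (T z)) \<le> 1/2 * dist y z" for y z
  proof (rule dist_bound)
    fix t :: real
    define c where "c = max 0 (min e t)"
    have c: "0 \<le> c" "c \<le> e" using e by (auto simp: c_def)
    have "dist (T y t) (T z t) =
        norm (integral {0..c} (\<lambda>s. G (apply_bcontfun y s) - G (apply_bcontfun z s)))"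
      unfolding T_def c_def[symmetric]
      by (subst integral_diff) (auto simp: dist_norm intro!: integrable_continuous_real cont)
    also have "\<dots> \<le> (L * dist y z) * (c - 0)"
    proof (rule integral_bound)
      fix s
      have "norm (G (apply_bcontfun y s) - G (apply_bcontfun z s))
          \<le> L * dist (apply_bcontfun y s) (apply_bcontfun z s)"
        using lipschitz_onD[OF L] by (simp add: dist_norm)
      also have "\<dots> \<le> L * dist y z"
        by (intro mult_left_mono dist_bounded L0)
      finally show "norm (G (apply_bcontfun y s) - G (apply_bcontfun z s)) \<le> L * dist y z" .
    qed (auto intro!: continuous_intros cont c)
    also have "\<dots> \<le> (L * dist y z) * e" using c L0 by (intro mult_left_mono) auto
    also have "\<dots> = L * e * dist y z" by simp
    also have "\<dots> \<le> 1/2 * dist y z" using e by (intro mult_right_mono) auto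
    finally show "dist (apply_bcontfun (Bcontfun (T y)) t) (apply_bcontfun (Bcontfun (T z)) t)
        \<le> 1/2 * dist y z"
      by (simp add: Bcontfun_inverse[OF T])
  qed
  then have "\<exists>!y. Bcontfun (T y) = y"
    by (intro banach_fix_type[where c = "1/2"]) auto
  then obtain y where "Bcontfun (T y) = y" by blast
  then have y: "apply_bcontfun y t = T y t" for t by (metis Bcontfun_inverse[OF T])
  have "(apply_bcontfun y has_vector_derivative G (apply_bcontfun y t)) (at t within {0..e})"
    if t: "t \<in> {0..e}" for t
  proof (rule has_vector_derivative_transform[OF t])
    show "((\<lambda>t. x + integral {0..t} (\<lambda>s. G (apply_bcontfun y s)))
        has_vector_derivative G (apply_bcontfun y t)) (at t within {0..e})"
      using has_vector_derivative_add[OF has_vector_derivative_const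
          integral_has_vector_derivative[OF cont t], of x] by simp
    show "apply_bcontfun y s = x + integral {0..s} (\<lambda>s. G (apply_bcontfun y s))" if "s \<in> {0..e}" for s
      using that y[of s] by (simp add: T_def)
  qed
  moreover have "apply_bcontfun y 0 = x" using y[of 0] e by (simp add: T_def)
  ultimately show ?thesis using e by blast
qed

text \<open>
The nearest-point retraction onto a ball does not increase distances, so composing with it
extends the right-hand side to a globally Lipschitz one; by continuity a solution of
the extended equation stays in the ball for a short time.
\<close>

lemma picard_local:
  fixes F :: "'a::euclidean_space \<Rightarrow> 'a"
  assumes L: "L-lipschitz_on (cball x r) F" and r: "0 < r"
  shows "\<exists>e>0. \<exists>y. y 0 = x \<and> (\<forall>t\<in>{0..e}. y t \<in> cball x r \<and>
    (y has_vector_derivative F (y t)) (at t within {0..e}))"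
proof -
  define P where "P = closest_point (cball x r)"
  have "L-lipschitz_on UNIV (F \<circ> P)"
  proof (rule lipschitz_onI)
    fix u v :: 'a
    have "P u \<in> cball x r" "P v \<in> cball x r"
      unfolding P_def by (rule closest_point_in_set; use r in simp)+
    then have "dist (F (P u)) (F (P v)) \<le> L * dist (P u) (P v)"
      using lipschitz_onD[OF L] by blast
    also have "\<dots> \<le> L * dist u v"
      unfolding P_def
      by (intro mult_left_mono closest_point_lipschitz lipschitz_on_nonneg[OF L]) (use r in auto)
    finally show "dist ((F \<circ> P) u) ((F \<circ> P) v) \<le> L * dist u v" by simp
  qed (rule lipschitz_on_nonneg[OF L])
  from picard_global[OF this, of x] obtain e y where e: "0 < e" and y0: "y 0 = x"
    and y: "\<And>t. t \<in> {0..e} \<Longrightarrow> (y has_vector_derivative F (P (y t))) (at t within {0..e})"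
    by auto
  have "continuous_on {0..e} y"
    using y has_vector_derivative_continuous by (force simp: continuous_on_eq_continuous_within)
  then obtain d where d: "0 < d" "\<And>t. t \<in> {0..e} \<Longrightarrow> dist t 0 < d \<Longrightarrow> dist (y t) (y 0) < r"
    using r e unfolding continuous_on_iff by (metis atLeastAtMost_iff less_eq_real_def order_refl)
  define e' where "e' = min e (d/2)"
  have "0 < e'" using e d by (simp add: e'_def)
  moreover have "y t \<in> cball x r \<and> (y has_vector_derivative F (y t)) (at t within {0..e'})"
    if t: "t \<in> {0..e'}" for t
  proof
    have "dist (y t) (y 0) < r" using d t e by (auto simp: e'_def dist_real_def)
    then show b: "y t \<in> cball x r" by (simp add: y0 dist_commute)
    then have "P (y t) = y t" unfolding P_def by (rule closest_point_self)
    then have "(y has_vector_derivative F (y t)) (at t within {0..e})"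
      using y[of t] t by (auto simp: e'_def)
    then show "(y has_vector_derivative F (y t)) (at t within {0..e'})"
      by (rule has_vector_derivative_within_subset) (auto simp: e'_def)
  qed
  ultimately show ?thesis using y0 by blast
qed

text \<open>
Two solutions with a common value at \<open>s\<close> have a distance \<open>f\<close> with \<open>f \<le> L d sup f \<le> sup f / 2\<close> on
the interval \<open>J\<close>, by the mean value inequality; hence \<open>sup f = 0\<close>. The interval \<open>J\<close> may be
one-sided at \<open>s\<close> and may lack its end points, as domains of integral paths do.
\<close>

lemma ode_unique_local:
  fixes y z :: "real \<Rightarrow> 'a::euclidean_space"
  assumes L: "L-lipschitz_on B F" and B: "bounded B"
    and J: "convex J" "s \<in> J" "J \<subseteq> cball s d" "L * d \<le> 1/2"
    and y: "\<And>t. t \<in> J \<Longrightarrow> y t \<in> B \<and> (y has_vector_derivative F (y t)) (at t within J)"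
    and z: "\<And>t. t \<in> J \<Longrightarrow> z t \<in> B \<and> (z has_vector_derivative F (z t)) (at t within J)"
    and eq: "y s = z s" and t: "t \<in> J"
  shows "y t = z t"
proof -
  define k where "k = (SUP t\<in>J. norm (y t - z t))"
  obtain b where b: "\<And>x. x \<in> B \<Longrightarrow> norm x \<le> b" using B by (auto simp: bounded_iff)
  have "norm (y t - z t) \<le> b + b" if "t \<in> J" for t
    using norm_triangle_ineq4[of "y t" "z t"] b y z that by (meson add_mono order_trans)
  then have bdd: "bdd_above ((\<lambda>t. norm (y t - z t)) ` J)" by (auto intro!: bdd_aboveI)
  have le: "norm (y t - z t) \<le> k" if "t \<in> J" for t
    unfolding k_def by (rule cSUP_upper[OF that bdd])
  have k0: "0 \<le> k" using le[OF J(2)] norm_ge_zero order_trans by blast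
  have L0: "0 \<le> L" using L lipschitz_on_nonneg by blast
  have half: "norm (y t - z t) \<le> k / 2" if t: "t \<in> J" for t
  proof -
    have "norm ((\<lambda>t. y t - z t) t - (\<lambda>t. y t - z t) s) \<le> (L * k) * norm (t - s)"
    proof (rule differentiable_bound[OF J(1) _ _ t J(2)])
      fix u assume u: "u \<in> J"
      show "((\<lambda>t. y t - z t) has_derivative (\<lambda>h. h *\<^sub>R (F (y u) - F (z u)))) (at u within J)"
        using has_vector_derivative_diff[of y _ "at u within J" z] y[OF u] z[OF u]
        by (simp add: has_vector_derivative_def)
      have *: "norm (F (y u) - F (z u)) \<le> L * k"
      proof -
        have "norm (F (y u) - F (z u)) \<le> L * norm (y u - z u)"
          using lipschitz_onD[OF L] y[OF u] z[OF u] by (simp add: dist_norm)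
        also have "\<dots> \<le> L * k" by (intro mult_left_mono le u L0)
        finally show ?thesis .
      qed
      show "onorm (\<lambda>h. h *\<^sub>R (F (y u) - F (z u))) \<le> L * k"
        by (rule onorm_le) (simp add: mult.commute mult_left_mono[OF *])
    qed
    also have "\<dots> \<le> (L * k) * d"
      using J(3) t L0 k0 by (intro mult_left_mono) (auto simp: dist_norm norm_minus_commute)
    also have "\<dots> = L * d * k" by simp
    also have "\<dots> \<le> 1/2 * k" by (intro mult_right_mono J k0)
    finally show ?thesis using eq by simp
  qed
  have "k \<le> k / 2" unfolding k_def
    by (rule cSUP_least) (use J(2) half in \<open>auto simp: k_def\<close>)
  then show ?thesis using le[OF t] k0 by simp
qed

text \<open>
\<^const>\<open>Ck_on\<close> provides continuity of the derivative in each fixed direction; summing over the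
basis directions bounds the operator norm on a compact ball.
\<close>

lemma C1_imp_locally_lipschitz:
  fixes F :: "'a::euclidean_space \<Rightarrow> 'b::euclidean_space"
  assumes U: "open U" "x \<in> U" and F: "Ck_on (Suc 0) F U"
  shows "\<exists>r>0. \<exists>L. L-lipschitz_on (cball x r) F"
proof -
  obtain r where r: "0 < r" "cball x r \<subseteq> U" using U open_contains_cball by blast
  define D where "D u = frechet_derivative F (at u)" for u
  have D: "(F has_derivative D u) (at u)" if "u \<in> U" for u
    using F that by (auto simp: D_def frechet_derivative_works)
  have "\<exists>b. \<forall>u\<in>cball x r. norm (D u i) \<le> b" for i
  proof -
    have "continuous_on (cball x r) (\<lambda>u. D u i)"
      using F r(2) by (auto simp: D_def intro: continuous_on_subset)
    then have "bounded ((\<lambda>u. D u i) ` cball x r)"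
      by (intro compact_imp_bounded compact_continuous_image) auto
    then show ?thesis by (auto simp: bounded_iff)
  qed
  then obtain b where b: "\<And>i u. u \<in> cball x r \<Longrightarrow> norm (D u i) \<le> b i" by metis
  define L where "L = (\<Sum>i\<in>Basis. b i)"
  have on: "norm (D u v) \<le> L * norm v" if u: "u \<in> cball x r" for u v
  proof -
    have lin: "linear (D u)" using D u r has_derivative_linear by blast
    have "D u v = D u (\<Sum>i\<in>Basis. (v \<bullet> i) *\<^sub>R i)" by (simp add: euclidean_representation)
    also have "\<dots> = (\<Sum>i\<in>Basis. (v \<bullet> i) *\<^sub>R D u i)"
      by (simp add: linear_sum[OF lin] linear_scale[OF lin])
    finally have "norm (D u v) \<le> (\<Sum>i\<in>Basis. norm ((v \<bullet> i) *\<^sub>R D u i))"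
      by (metis norm_sum)
    also have "\<dots> \<le> (\<Sum>i\<in>Basis. norm v * b i)"
      by (rule sum_mono) (auto intro!: mult_mono Basis_le_norm b u)
    finally show ?thesis by (simp add: L_def sum_distrib_left mult.commute)
  qed
  have L0: "0 \<le> L"
    unfolding L_def using order_trans[OF norm_ge_zero b[of x]] r by (intro sum_nonneg) simp
  have "L-lipschitz_on (cball x r) F"
  proof (rule lipschitz_onI[OF _ L0])
    fix u v assume uv: "u \<in> cball x r" "v \<in> cball x r"
    have "norm (F u - F v) \<le> L * norm (u - v)"
    proof (rule differentiable_bound[OF convex_cball _ _ uv])
      fix w assume w: "w \<in> cball x r"
      show "(F has_derivative D w) (at w within cball x r)"
        using D r w has_derivative_at_withinI by blast
      show "onorm (D w) \<le> L" by (rule onorm_le) (rule on[OF w])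
    qed
    then show "dist (F u) (F v) \<le> L * dist u v" by (simp add: dist_norm)
  qed
  then show ?thesis using r by blast
qed


section \<open>Charts with values in a half-space\<close>

text \<open>
The unit vector \<open>b\<close> is the inner normal of the half-space: the sign of \<open>v \<bullet> b\<close> decides
whether \<open>v\<close> points inwards, outwards or along the boundary.
\<close>

lemma model_space_cases:
  assumes "model_space H"
  obtains (point) "H = {0}" "rel_interior H = {0}" "rel_frontier H = {}"
  | (half_space) b where "b \<bullet> b = 1" "H = {x. 0 \<le> x \<bullet> b}"
      "rel_interior H = {x. 0 < x \<bullet> b}" "rel_frontier H = {x. x \<bullet> b = 0}"
proof -
  consider "H = {0}" | b where "b \<in> Basis" "H = {x. 0 \<le> x \<bullet> b}"
    using assms by (auto simp: model_space_def)
  then show thesis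
  proof cases
    case 1
    then show thesis by (intro point) auto
  next
    case 2
    then have b: "b \<noteq> 0" "b \<bullet> b = 1" by auto
    have H: "H = {x. b \<bullet> x \<ge> 0}" using 2 by (simp add: inner_commute)
    have i: "interior H = {x. 0 < x \<bullet> b}"
      unfolding H using b interior_halfspace_ge[of b 0] by (simp add: inner_commute)
    moreover have "b \<in> interior H" using i b by simp
    ultimately have "rel_interior H = {x. 0 < x \<bullet> b}" by (metis empty_iff rel_interior_nonempty_interior)
    moreover have "rel_frontier H = {x. x \<bullet> b = 0}"
      using \<open>b \<in> interior H\<close> rel_frontier_nonempty_interior[of H] frontier_halfspace_ge[of b 0] b
      by (auto simp: H inner_commute)
    ultimately show thesis using half_space b 2 by blast
  qed
qed

lemma coord_rep_eq: "coord_rep c d f = snd d \<circ> f \<circ> inv_into (fst c) (snd c)"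
  by (cases c; cases d) simp

lemma coord_dom_eq: "coord_dom c d f = snd c ` (fst c \<inter> f -` fst d)"
  by (cases c; cases d) simp

lemma smooth_on_imp_differentiable_within:
  assumes "smooth_on S f" "x \<in> S"
  shows "f differentiable (at x within S)"
proof -
  obtain U F where U: "open U" "x \<in> U" "\<forall>k. Ck_on k F U" "\<forall>y\<in>S \<inter> U. F y = f y"
    using assms unfolding smooth_on_def by blast
  have "F differentiable (at x)" using spec[OF U(3), of "Suc 0"] U(2) by simp
  then obtain D where "(F has_derivative D) (at x)" by (auto simp: differentiable_def)
  then have "(F has_derivative D) (at x within S \<inter> U)" by (rule has_derivative_at_withinI)
  then have "(f has_derivative D) (at x within S \<inter> U)"
    by (rule has_derivative_transform[rotated 2]) (use assms U in auto)
  then have "(f has_derivative D) (at x within S)"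
    using at_within_nhd[of x U S "S \<inter> U"] U by auto
  then show ?thesis by (auto simp: differentiable_def)
qed

text \<open>
Every use of differentials below goes through curves: a vector is the velocity
of a curve in one chart, and its image under the derivative of a coordinate representation is the
velocity of the image curve in another chart. As a vector derivative within a nondegenerate
interval is unique, this replaces any discussion of uniqueness of derivatives within half-spaces.
With \<open>f = id\<close> it describes changes of charts.
\<close>

lemma curve_derivative_chain:
  assumes c: "p \<in> fst c" "open (fst c)" "inj_on (snd c) (fst c)"
    and d: "f p \<in> fst d" "open (fst d)"
    and f: "continuous_on UNIV f"
    and \<gamma>: "continuous (at t within I) \<gamma>" "t \<in> I" "\<gamma> t = p"
    and v: "((snd c \<circ> \<gamma>) has_vector_derivative v) (at t within I)"
    and diff: "coord_rep c d f differentiable (at (snd c p) within coord_dom c d f)"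
  shows "((snd d \<circ> (f \<circ> \<gamma>)) has_vector_derivative
      frechet_derivative (coord_rep c d f) (at (snd c p) within coord_dom c d f) v) (at t within I)"
proof -
  let ?D = "frechet_derivative (coord_rep c d f) (at (snd c p) within coord_dom c d f)"
  define W where "W = fst c \<inter> f -` fst d"
  have "open W" unfolding W_def using c d f by (intro open_Int open_vimage) auto
  moreover have "\<gamma> t \<in> W" using c d \<gamma> by (simp add: W_def)
  ultimately obtain O' where O': "open O'" "t \<in> O'" "\<And>s. s \<in> I \<Longrightarrow> s \<in> O' \<Longrightarrow> \<gamma> s \<in> W"
    using \<gamma>(1) unfolding continuous_within_topological by metis
  define J where "J = I \<inter> O'"
  have at: "at t within I = at t within J"
    using at_within_nhd[of t O' I J] O' by (auto simp: J_def)
  have im: "(snd c \<circ> \<gamma>) ` J \<subseteq> coord_dom c d f"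
    using O' by (auto simp: J_def coord_dom_eq W_def)
  have "(coord_rep c d f has_derivative ?D) (at (snd c p) within (snd c \<circ> \<gamma>) ` J)"
    using diff[unfolded frechet_derivative_works] im by (rule has_derivative_subset)
  then have "((coord_rep c d f \<circ> (snd c \<circ> \<gamma>)) has_vector_derivative ?D v) (at t within J)"
    using vector_derivative_diff_chain_within[OF v[unfolded at], of "coord_rep c d f" ?D] \<gamma>(3) by simp
  then have "((snd d \<circ> (f \<circ> \<gamma>)) has_vector_derivative ?D v) (at t within J)"
    by (rule has_vector_derivative_transform[rotated 2])
      (use \<gamma> O' c in \<open>auto simp: J_def coord_rep_eq W_def\<close>)
  then show ?thesis by (simp add: at)
qed

locale manifold_with_boundary =
  fixes H :: "'e::euclidean_space set"
    and A :: "('m::{t2_space, second_countable_topology}, 'e) chart set"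
  assumes smooth_manifold: "smooth_manifold H A"
begin

lemma model: "model_space H"
  using smooth_manifold by (simp add: smooth_manifold_def)

lemma charts_at_nonempty: "\<exists>c. c \<in> charts_at A p"
proof -
  have "p \<in> (\<Union>c\<in>A. fst c)" using smooth_manifold by (simp add: smooth_manifold_def)
  then show ?thesis by (auto simp: charts_at_def)
qed

lemma chart:
  assumes "c \<in> charts_at A p"
  shows "c \<in> A" "p \<in> fst c" "open (fst c)" "openin (top_of_set H) (snd c ` fst c)"
    "continuous_on (fst c) (snd c)" "inj_on (snd c) (fst c)"
    "continuous_on (snd c ` fst c) (inv_into (fst c) (snd c))" "snd c p \<in> H"
proof -
  show *: "c \<in> A" "p \<in> fst c" using assms by (auto simp: charts_at_def)
  have c: "chart_on H c" using smooth_manifold * by (auto simp: smooth_manifold_def)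
  then have h: "homeomorphism (fst c) (snd c ` fst c) (snd c) (inv_into (fst c) (snd c))"
    by (auto simp: chart_on_def)
  show "open (fst c)" "openin (top_of_set H) (snd c ` fst c)" using c by (auto simp: chart_on_def)
  then show "snd c p \<in> H" using * openin_imp_subset by blast
  show "continuous_on (fst c) (snd c)" "continuous_on (snd c ` fst c) (inv_into (fst c) (snd c))"
    using h by (auto simp: homeomorphism_def)
  show "inj_on (snd c) (fst c)" using h by (auto simp: homeomorphism_def intro!: inj_on_inverseI)
qed

lemma open_image_in_model:
  assumes c: "c \<in> charts_at A p" and W: "open W"
  shows "openin (top_of_set H) (snd c ` (fst c \<inter> W))"
proof -
  have "homeomorphism (fst c) (snd c ` fst c) (snd c) (inv_into (fst c) (snd c))"
    using chart[OF c] by (intro homeomorphismI) auto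
  then have "openin (top_of_set (snd c ` fst c)) (snd c ` (fst c \<inter> W))"
    using W by (rule homeomorphism_imp_open_map[OF _ openin_open_Int])
  then show ?thesis using chart(4)[OF c] openin_trans by blast
qed

lemma transition_differentiable:
  assumes "c \<in> charts_at A p" "d \<in> charts_at A p"
  shows "coord_rep c d id differentiable (at (snd c p) within coord_dom c d id)"
  by (rule smooth_on_imp_differentiable_within)
    (use smooth_manifold chart[OF assms(1)] chart[OF assms(2)]
     in \<open>auto simp: smooth_manifold_def coord_dom_eq\<close>)

lemma curve_chart_change:
  assumes c: "c \<in> charts_at A p" and d: "d \<in> charts_at A p"
    and \<gamma>: "continuous (at t within I) \<gamma>" "t \<in> I" "\<gamma> t = p"
    and v: "((snd c \<circ> \<gamma>) has_vector_derivative v) (at t within I)"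
  shows "((snd d \<circ> \<gamma>) has_vector_derivative
      frechet_derivative (coord_rep c d id) (at (snd c p) within coord_dom c d id) v) (at t within I)"
  using curve_derivative_chain[of p c id d t I \<gamma> v] chart[OF c] chart[OF d] \<gamma> v
    transition_differentiable[OF c d] continuous_on_id by (auto simp: id_def o_def)

text \<open>
These curves realize a prescribed velocity, as long as the line segment stays in the image of the chart.
\<close>

lemma chart_line_curve:
  assumes c: "c \<in> charts_at A p" and I: "0 \<in> I" and im: "\<And>t. t \<in> I \<Longrightarrow> snd c p + t *\<^sub>R v \<in> snd c ` fst c"
  defines "\<gamma> \<equiv> \<lambda>t. inv_into (fst c) (snd c) (snd c p + t *\<^sub>R v)"
  shows "\<gamma> 0 = p" "continuous_on I \<gamma>"
    "\<And>t. t \<in> I \<Longrightarrow> ((snd c \<circ> \<gamma>) has_vector_derivative v) (at t within I)"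
proof -
  show "\<gamma> 0 = p" using chart[OF c] by (simp add: \<gamma>_def)
  show "continuous_on I \<gamma>" unfolding \<gamma>_def
    by (rule continuous_on_compose2[OF chart(7)[OF c]]) (use im in \<open>auto intro!: continuous_intros\<close>)
  have *: "snd c (\<gamma> t) = snd c p + t *\<^sub>R v" if "t \<in> I" for t
    unfolding \<gamma>_def using im[OF that] by (rule f_inv_into_f)
  show "((snd c \<circ> \<gamma>) has_vector_derivative v) (at t within I)" if "t \<in> I" for t
  proof (rule has_vector_derivative_transform[OF that])
    show "((\<lambda>t. snd c p + t *\<^sub>R v) has_vector_derivative v) (at t within I)"
      by (auto intro!: derivative_eq_intros)
  qed (use * in auto)
qed

text \<open>
Smooth invariance of the boundary. Suppose that \<open>p\<close> is mapped to the boundary by \<open>d\<close> and to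
the interior by \<open>c\<close>. The normal component of the transition map from \<open>c\<close> to \<open>d\<close> is nonnegative on an
open set and vanishes at \<open>c p\<close>, so its derivative vanishes there. But the curve
leaving \<open>p\<close> in the direction of the inner normal \<open>b\<close> of \<open>d\<close>, seen in \<open>c\<close> and transported back to \<open>d\<close>,
shows that \<open>b\<close> lies in the image of this derivative.
\<close>

lemma boundary_in_every_chart:
  assumes p: "p \<in> boundary_points H A" and c: "c \<in> charts_at A p"
  shows "snd c p \<in> rel_frontier H"
proof -
  obtain d where d: "d \<in> charts_at A p" "snd d p \<in> rel_frontier H"
    using p by (force simp: boundary_points_def charts_at_def)
  show ?thesis
    using model
  proof (cases rule: model_space_cases)
    case point
    then show ?thesis using d by simp
  next
    case (half_space b)
    show ?thesis
    proof (rule ccontr)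
      assume "snd c p \<notin> rel_frontier H"
      then have pos: "0 < snd c p \<bullet> b" using chart(8)[OF c] half_space by auto
      obtain e where e: "0 < e" "H \<inter> cball (snd d p) e \<subseteq> snd d ` fst d"
        using chart(4)[OF d(1)] chart(2)[OF d(1)]
        by (auto simp: openin_contains_cball Int_commute)
      have im: "snd d p + t *\<^sub>R b \<in> snd d ` fst d" if "t \<in> {0..e}" for t
      proof -
        have "norm b = 1" using half_space by (simp add: norm_eq_1)
        then have "snd d p + t *\<^sub>R b \<in> H \<inter> cball (snd d p) e"
          using that d half_space by (auto simp: dist_norm inner_add_left)
        then show ?thesis using e by blast
      qed
      \<comment> \<open>The velocity of this curve at \<open>p\<close> is \<open>b\<close> in the chart \<open>d\<close> and \<open>v\<close> in the chart \<open>c\<close>.\<close>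
      define \<gamma> where "\<gamma> = (\<lambda>t. inv_into (fst d) (snd d) (snd d p + t *\<^sub>R b))"
      have z: "0 \<in> {0..e}" using e by simp
      have \<gamma>0: "\<gamma> 0 = p" unfolding \<gamma>_def by (rule chart_line_curve(1)[OF d(1) z im])
      have \<gamma>c: "continuous (at 0 within {0..e}) \<gamma>"
        using chart_line_curve(2)[OF d(1) z im] z
        by (auto simp: \<gamma>_def continuous_on_eq_continuous_within)
      have \<gamma>d: "((snd d \<circ> \<gamma>) has_vector_derivative b) (at 0 within {0..e})"
        unfolding \<gamma>_def by (rule chart_line_curve(3)[OF d(1) z im z])
      define v where "v = frechet_derivative (coord_rep d c id) (at (snd d p) within coord_dom d c id) b"
      define D where "D = frechet_derivative (coord_rep c d id) (at (snd c p) within coord_dom c d id)"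
      have "((snd c \<circ> \<gamma>) has_vector_derivative v) (at 0 within {0..e})"
        unfolding v_def using curve_chart_change[OF d(1) c \<gamma>c _ \<gamma>0 \<gamma>d] e by auto
      then have "((snd d \<circ> \<gamma>) has_vector_derivative D v) (at 0 within {0..e})"
        unfolding D_def using curve_chart_change[OF c d(1) \<gamma>c _ \<gamma>0] e by auto
      then have Dv: "D v = b"
        using vector_derivative_unique_within_closed_interval[of 0 e 0] \<gamma>d e by (auto simp: cbox_interval)
      define S where "S = coord_dom c d id \<inter> {x. 0 < x \<bullet> b}"
      have "openin (top_of_set H) (coord_dom c d id)"
        using open_image_in_model[OF c chart(3)[OF d(1)]] by (simp add: coord_dom_eq)
      then obtain T where T: "open T" "coord_dom c d id = H \<inter> T" by (auto simp: openin_open)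
      have "S = T \<inter> {x. 0 < x \<bullet> b}" using T half_space by (auto simp: S_def)
      then have S: "open S" using T open_halfspace_gt[of 0 b] by (auto simp: inner_commute)
      have pS: "snd c p \<in> S"
        using pos chart[OF c] chart[OF d(1)] by (auto simp: S_def coord_dom_eq)
      have "(coord_rep c d id has_derivative D) (at (snd c p) within coord_dom c d id)"
        unfolding D_def using transition_differentiable[OF c d(1)] frechet_derivative_works by blast
      then have "(coord_rep c d id has_derivative D) (at (snd c p) within S)"
        by (rule has_derivative_subset) (auto simp: S_def)
      then have "(coord_rep c d id has_derivative D) (at (snd c p))"
        by (simp only: at_within_open[OF pS S])
      then have "((\<lambda>x. coord_rep c d id x \<bullet> b) has_derivative (\<lambda>h. D h \<bullet> b)) (at (snd c p))"
        by (rule has_derivative_inner_left)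
      moreover have "coord_rep c d id (snd c p) \<bullet> b \<le> coord_rep c d id x \<bullet> b" if x: "x \<in> S" for x
      proof -
        obtain q where q: "q \<in> fst c" "q \<in> fst d" "x = snd c q"
          using x by (auto simp: S_def coord_dom_eq)
        then have "snd d q \<in> H" using chart(4)[OF d(1)] openin_imp_subset by blast
        then show ?thesis
          using q d chart[OF c] half_space by (auto simp: coord_rep_eq)
      qed
      ultimately have "(\<lambda>h. D h \<bullet> b) = (\<lambda>h. 0)"
        using differential_zero_maxmin[OF pS S, of "\<lambda>x. coord_rep c d id x \<bullet> b"] by blast
      then have "D v \<bullet> b = 0" by metis
      then show False using Dv half_space by simp
    qed
  qed
qed

end


section \<open>Integral paths\<close>

lemma integral_path_on_subset:
  assumes "integral_path_on A X g I \<gamma>" "is_interval J" "0 \<in> J" "J \<subseteq> I"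
  shows "integral_path_on A X g J \<gamma>"
  unfolding integral_path_on_def
proof (intro conjI ballI)
  note \<gamma> = assms(1)[unfolded integral_path_on_def]
  show "continuous_on J \<gamma>" using \<gamma> assms(4) continuous_on_subset by blast
  show "((snd c \<circ> \<gamma>) has_vector_derivative X (\<gamma> t) c) (at t within J)"
    if "t \<in> J" "c \<in> charts_at A (\<gamma> t)" for t c
    using \<gamma> that assms(4) has_vector_derivative_within_subset by blast
qed (use assms in \<open>simp_all add: integral_path_on_def\<close>)

text \<open>
Reversing time turns integral paths of \<open>X\<close> into integral paths of \<open>-X\<close>, so that existence and
extension of paths need to be studied for nonnegative times only.
\<close>

lemma integral_path_on_uminus:
  assumes "integral_path_on A X g I \<gamma>"
  shows "integral_path_on A (\<lambda>p c. - X p c) g (uminus ` I) (\<lambda>t. \<gamma> (- t))"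
  unfolding integral_path_on_def
proof (intro conjI ballI)
  note \<gamma> = assms[unfolded integral_path_on_def]
  show "is_interval (uminus ` I)" using \<gamma> by (simp add: is_interval_uminus)
  show "0 \<in> uminus ` I" "\<gamma> (- 0) = g" using \<gamma> by force+
  show "continuous_on (uminus ` I) (\<lambda>t. \<gamma> (- t))"
    by (rule continuous_on_compose2[of I]) (use \<gamma> in \<open>auto intro!: continuous_intros\<close>)
  fix t c assume t: "t \<in> uminus ` I" and c: "c \<in> charts_at A (\<gamma> (- t))"
  have "((snd c \<circ> \<gamma>) has_vector_derivative X (\<gamma> (- t)) c) (at (- t) within uminus ` uminus ` I)"
    using \<gamma> t c by (auto simp: image_image)
  then have "(((snd c \<circ> \<gamma>) \<circ> uminus) has_vector_derivative (- 1) *\<^sub>R X (\<gamma> (- t)) c) (at t within uminus ` I)"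
    by (intro vector_diff_chain_within) (auto intro!: derivative_eq_intros)
  then show "((snd c \<circ> (\<lambda>t. \<gamma> (- t))) has_vector_derivative - X (\<gamma> (- t)) c) (at t within uminus ` I)"
    by (simp add: o_def)
qed

lemma path_domain_uminus:
  "path_domain A (\<lambda>p c. - X p c) g = uminus ` path_domain A X g"
proof -
  have sub: "uminus ` path_domain A Y g \<subseteq> path_domain A (\<lambda>p c. - Y p c) g" for Y
    unfolding path_domain_def using integral_path_on_uminus[of A Y g] by fast
  have "path_domain A (\<lambda>p c. - X p c) g = uminus ` uminus ` path_domain A (\<lambda>p c. - X p c) g"
    by (simp add: image_image)
  also have "\<dots> \<subseteq> uminus ` path_domain A X g"
    using sub[of "\<lambda>p c. - X p c"] by (intro image_mono) simp
  finally show ?thesis using sub[of X] by blast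
qed

lemma has_vector_derivative_within_union:
  assumes "(f has_vector_derivative v) (at x within S)" "(f has_vector_derivative v) (at x within T)"
  shows "(f has_vector_derivative v) (at x within S \<union> T)"
  using assms unfolding has_vector_derivative_def has_derivative_iff_norm Lim_within_Un by blast

text \<open>
Away from a closed set the filter \<^term>\<open>at x within S\<close> is trivial. Together with the previous lemma
this allows the two pieces of a concatenated path to be treated separately, with no case distinction
between the junction and the other points.
\<close>

lemma has_vector_derivative_outside_closed:
  assumes "closed S" "x \<notin> S"
  shows "(f has_vector_derivative v) (at x within S)"
proof -
  have "at x within S = bot"
    using assms closed_limpt trivial_limit_within by blast
  then show ?thesis
    by (simp add: has_vector_derivative_def has_derivative_def bounded_linear_scaleR_left)
qed

lemma integral_path_on_concat:
  assumes \<alpha>: "integral_path_on A X g {0..a} \<alpha>" and \<beta>: "integral_path_on A X (\<alpha> a) {0..b} \<beta>"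
    and ab: "0 \<le> a" "0 \<le> b"
  shows "integral_path_on A X g {0..a+b} (\<lambda>t. if t \<le> a then \<alpha> t else \<beta> (t - a))" (is "integral_path_on A X g _ ?\<gamma>")
  unfolding integral_path_on_def
proof (intro conjI ballI)
  note \<alpha>' = \<alpha>[unfolded integral_path_on_def] and \<beta>' = \<beta>[unfolded integral_path_on_def]
  show "is_interval {0..a+b}" by (rule is_interval_cc)
  show "0 \<in> {0..a+b}" "?\<gamma> 0 = g" using ab \<alpha>' by auto
  have split: "{0..a+b} = {0..a} \<union> {a..a+b}" using ab by auto
  have \<gamma>\<alpha>: "?\<gamma> t = \<alpha> t" if "t \<in> {0..a}" for t using that by auto
  have \<gamma>\<beta>: "?\<gamma> t = \<beta> (t - a)" if "t \<in> {a..a+b}" for t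
    using that \<beta>' by (cases "t = a") auto
  have "continuous_on {a..a+b} (\<lambda>t. \<beta> (t - a))"
    by (rule continuous_on_compose2[of "{0..b}"]) (use \<beta>' in \<open>auto intro!: continuous_intros\<close>)
  then have c2: "continuous_on {a..a+b} ?\<gamma>"
    by (rule continuous_on_eq) (rule \<gamma>\<beta>[symmetric])
  have "continuous_on {0..a} \<alpha>" using \<alpha>' by blast
  then have c1: "continuous_on {0..a} ?\<gamma>"
    by (rule continuous_on_eq) (rule \<gamma>\<alpha>[symmetric])
  show "continuous_on {0..a+b} ?\<gamma>"
    unfolding split by (rule continuous_on_closed_Un[OF _ _ c1 c2]) auto
  fix t c assume t: "t \<in> {0..a+b}" and c: "c \<in> charts_at A (?\<gamma> t)"
  let ?v = "X (?\<gamma> t) c"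
  have "((snd c \<circ> ?\<gamma>) has_vector_derivative ?v) (at t within {0..a})"
  proof (cases "t \<in> {0..a}")
    case True
    show ?thesis
    proof (rule has_vector_derivative_transform[OF True])
      show "((snd c \<circ> \<alpha>) has_vector_derivative ?v) (at t within {0..a})"
        using \<alpha>' c True by (simp add: \<gamma>\<alpha>)
    qed (simp add: \<gamma>\<alpha>)
  qed (rule has_vector_derivative_outside_closed; simp)
  moreover have "((snd c \<circ> ?\<gamma>) has_vector_derivative ?v) (at t within {a..a+b})"
  proof (cases "t \<in> {a..a+b}")
    case True
    show ?thesis
    proof (rule has_vector_derivative_transform[OF True])
      have im: "(\<lambda>t. t - a) ` {a..a+b} = {0..b}"
        by (auto simp: image_def intro!: bexI[of _ "_ + a"])
      have "((snd c \<circ> \<beta>) has_vector_derivative ?v) (at (t - a) within (\<lambda>t. t - a) ` {a..a+b})"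
        unfolding im using \<beta>' c True \<gamma>\<beta>[OF True] by auto
      moreover have "((\<lambda>t. t - a) has_vector_derivative 1) (at t within {a..a+b})"
        by (auto intro!: derivative_eq_intros)
      ultimately show "((snd c \<circ> \<beta> \<circ> (\<lambda>t. t - a)) has_vector_derivative ?v) (at t within {a..a+b})"
        using vector_diff_chain_within by fastforce
      show "(snd c \<circ> ?\<gamma>) s = (snd c \<circ> \<beta> \<circ> (\<lambda>t. t - a)) s" if "s \<in> {a..a+b}" for s
        using \<gamma>\<beta>[OF that] by simp
    qed
  qed (rule has_vector_derivative_outside_closed; simp)
  ultimately show "((snd c \<circ> ?\<gamma>) has_vector_derivative ?v) (at t within {0..a+b})"
    unfolding split by (rule has_vector_derivative_within_union)
qed

text \<open>
If paths from every point live for the same time \<open>e\<close>, then a path can be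
prolonged by \<open>e\<close> again and again, starting each time at the end point reached before.
\<close>

lemma uniform_forward_time_imp_forward_complete:
  assumes e: "0 < e" and ex: "\<And>g. \<exists>\<gamma>. integral_path_on A X g {0..e} \<gamma>"
  shows "{0..} \<subseteq> path_domain A X g"
proof
  fix t :: real assume "t \<in> {0..}"
  have *: "\<exists>\<gamma>. integral_path_on A X g {0..real n * e} \<gamma>" for n
  proof (induction n)
    case 0
    obtain \<gamma> where "integral_path_on A X g {0..e} \<gamma>" using ex by blast
    then have "integral_path_on A X g {0..0} \<gamma>"
      by (rule integral_path_on_subset) (use e in \<open>auto simp: is_interval_1\<close>)
    then show ?case by auto
  next
    case (Suc n)
    then obtain \<alpha> where \<alpha>: "integral_path_on A X g {0..real n * e} \<alpha>" by blast
    obtain \<beta> where \<beta>: "integral_path_on A X (\<alpha> (real n * e)) {0..e} \<beta>" using ex by blast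
    show ?case using integral_path_on_concat[OF \<alpha> \<beta>] e by (auto simp: algebra_simps)
  qed
  obtain n where "t \<le> real n * e"
    using reals_Archimedean3[OF e] less_imp_le by blast
  then show "t \<in> path_domain A X g"
    using *[of n] \<open>t \<in> {0..}\<close> by (auto simp: path_domain_def)
qed

text \<open>
What the theory of ordinary differential equations needs from a smooth vector field: in each
chart it extends, near each point, to a Lipschitz map on a full ball of the ambient space, possibly beyond
the boundary. In contrast to smoothness, this passes to \<open>-X\<close> immediately, as time reversal
requires.
\<close>

definition lipschitz_field ::
  "'e::euclidean_space set \<Rightarrow> ('m, 'e) chart set \<Rightarrow> ('m \<Rightarrow> ('m, 'e) tvec) \<Rightarrow> bool" where
  "lipschitz_field H A X \<longleftrightarrow>
     (\<forall>p. X p \<in> tangent_space H A p) \<and>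
     (\<forall>p. \<forall>c\<in>charts_at A p. \<exists>F r L. 0 < r \<and> L-lipschitz_on (cball (snd c p) r) F \<and>
        (\<forall>q\<in>fst c. snd c q \<in> cball (snd c p) r \<longrightarrow> X q c = F (snd c q)))"

lemma lipschitz_fieldE:
  assumes "lipschitz_field H A X" "c \<in> charts_at A p"
  obtains F r L where "0 < r" "L-lipschitz_on (cball (snd c p) r) F"
    "\<forall>q\<in>fst c. snd c q \<in> cball (snd c p) r \<longrightarrow> X q c = F (snd c q)"
  using assms unfolding lipschitz_field_def by blast

lemma tangent_spaceD:
  assumes "v \<in> tangent_space H A p"
  shows "c \<in> charts_at A p \<Longrightarrow> v c \<in> span H"
    "c \<notin> charts_at A p \<Longrightarrow> v c = 0"
    "c \<in> charts_at A p \<Longrightarrow> d \<in> charts_at A p \<Longrightarrow>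
      v d = frechet_derivative (coord_rep c d id) (at (snd c p) within coord_dom c d id) (v c)"
  using assms unfolding tangent_space_def by blast+

context manifold_with_boundary
begin

lemma vector_field_imp_lipschitz_field:
  assumes X: "vector_field H A X"
  shows "lipschitz_field H A X"
  unfolding lipschitz_field_def
proof (intro conjI allI ballI)
  show "X p \<in> tangent_space H A p" for p using X by (simp add: vector_field_def)
  fix p c assume c: "c \<in> charts_at A p"
  have "smooth_on (snd c ` fst c) (\<lambda>x. X (inv_into (fst c) (snd c) x) c)"
    using X chart(1)[OF c] by (cases c) (auto simp: vector_field_def)
  then obtain U F where U: "open U" "snd c p \<in> U" "\<forall>k. Ck_on k F U"
      "\<forall>y\<in>snd c ` fst c \<inter> U. F y = X (inv_into (fst c) (snd c) y) c"
    unfolding smooth_on_def using chart(2)[OF c] by blast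
  obtain r L where r: "0 < r" "L-lipschitz_on (cball (snd c p) r) F"
    using C1_imp_locally_lipschitz[OF U(1,2) spec[OF U(3)]] by blast
  obtain s where s: "0 < s" "cball (snd c p) s \<subseteq> U" using U open_contains_cball by blast
  have "L-lipschitz_on (cball (snd c p) (min r s)) F"
    using r(2) by (rule lipschitz_on_subset) auto
  moreover have "\<forall>q\<in>fst c. snd c q \<in> cball (snd c p) (min r s) \<longrightarrow> X q c = F (snd c q)"
    using U(4) s chart(6)[OF c] by auto
  ultimately show "\<exists>F r L. 0 < r \<and> L-lipschitz_on (cball (snd c p) r) F \<and>
        (\<forall>q\<in>fst c. snd c q \<in> cball (snd c p) r \<longrightarrow> X q c = F (snd c q))"
    using r s by (intro exI[of _ F] exI[of _ "min r s"] exI[of _ L]) simp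
qed

lemma lipschitz_field_uminus:
  assumes X: "lipschitz_field H A X"
  shows "lipschitz_field H A (\<lambda>p c. - X p c)"
  unfolding lipschitz_field_def
proof (intro conjI allI ballI)
  fix p
  have Xp: "X p \<in> tangent_space H A p" using X by (simp add: lipschitz_field_def)
  show "(\<lambda>c. - X p c) \<in> tangent_space H A p"
    unfolding tangent_space_def
  proof (intro CollectI conjI ballI allI impI)
    fix c d assume c: "c \<in> charts_at A p" and d: "d \<in> charts_at A p"
    have "linear (frechet_derivative (coord_rep c d id) (at (snd c p) within coord_dom c d id))"
      using transition_differentiable[OF c d] by (rule linear_frechet_derivative)
    then show "- X p d = frechet_derivative (coord_rep c d id)
        (at (snd c p) within coord_dom c d id) (- X p c)"
      using tangent_spaceD(3)[OF Xp c d] by (simp add: linear_neg)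
  next
    show "- X p c \<in> span H" if "c \<in> charts_at A p" for c
      using tangent_spaceD(1)[OF Xp that] by (rule span_neg)
    show "- X p c = 0" if "c \<notin> charts_at A p" for c
      using tangent_spaceD(2)[OF Xp that] by simp
  qed
  fix c assume "c \<in> charts_at A p"
  from lipschitz_fieldE[OF X this] obtain F r L where F: "0 < r" "L-lipschitz_on (cball (snd c p) r) F"
        "\<forall>q\<in>fst c. snd c q \<in> cball (snd c p) r \<longrightarrow> X q c = F (snd c q)" .
  then show "\<exists>F r L. 0 < r \<and> L-lipschitz_on (cball (snd c p) r) F \<and>
        (\<forall>q\<in>fst c. snd c q \<in> cball (snd c p) r \<longrightarrow> - X q c = F (snd c q))"
    by (intro exI[of _ "\<lambda>x. - F x"] exI[of _ r] exI[of _ L]) (simp add: lipschitz_on_minus)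
qed

lemma integral_path_in_chart_nbhd:
  assumes \<gamma>: "integral_path_on A X g I \<gamma>" and s: "s \<in> I" and c: "c \<in> charts_at A (\<gamma> s)" and r: "0 < r"
  shows "\<exists>d>0. \<forall>t\<in>I. dist t s < d \<longrightarrow> \<gamma> t \<in> fst c \<and> snd c (\<gamma> t) \<in> cball (snd c (\<gamma> s)) r"
proof -
  have "open (fst c \<inter> snd c -` ball (snd c (\<gamma> s)) r)"
    using chart[OF c] by (intro continuous_open_preimage) auto
  moreover have "continuous (at s within I) \<gamma>"
    using \<gamma> s by (auto simp: integral_path_on_def continuous_on_eq_continuous_within)
  ultimately obtain U where U: "open U" "s \<in> U"
      "\<forall>t\<in>I. t \<in> U \<longrightarrow> \<gamma> t \<in> fst c \<inter> snd c -` ball (snd c (\<gamma> s)) r"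
    unfolding continuous_within_topological using chart(2)[OF c] r
    by (metis Int_iff centre_in_ball vimage_eq)
  obtain d where "0 < d" "ball s d \<subseteq> U" using U open_contains_ball by blast
  then show ?thesis using U(3) by (intro exI[of _ d]) (force simp: dist_commute)
qed

text \<open>
The set of times at which the two paths agree is closed because the manifold is Hausdorff, open by
local uniqueness in a chart, and contains \<open>0\<close>; the common domain is connected.
\<close>

lemma integral_path_unique:
  assumes X: "lipschitz_field H A X"
    and \<gamma>: "integral_path_on A X g I \<gamma>" and \<delta>: "integral_path_on A X g J \<delta>"
    and t: "t \<in> I" "t \<in> J"
  shows "\<gamma> t = \<delta> t"
proof -
  define K where "K = I \<inter> J"
  have K: "is_interval K" "0 \<in> K"
    using \<gamma> \<delta> by (auto simp: K_def integral_path_on_def intro: is_interval_Int)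
  have \<gamma>K: "integral_path_on A X g K \<gamma>" using \<gamma> K by (rule integral_path_on_subset) (simp add: K_def)
  have \<delta>K: "integral_path_on A X g K \<delta>" using \<delta> K by (rule integral_path_on_subset) (simp add: K_def)
  note \<gamma>' = \<gamma>K[unfolded integral_path_on_def] and \<delta>' = \<delta>K[unfolded integral_path_on_def]
  define S where "S = {t \<in> K. \<gamma> t = \<delta> t}"
  have "{(x, y). x = y} = {y. \<exists>x::'m. y = (x, x)}" by auto
  then have "closedin (top_of_set K) (K \<inter> (\<lambda>t. (\<gamma> t, \<delta> t)) -` {(x, y). x = y})"
    using \<gamma>' \<delta>' closed_diagonal[where 'a = 'm]
    by (intro continuous_closedin_preimage continuous_on_Pair) auto
  moreover have "K \<inter> (\<lambda>t. (\<gamma> t, \<delta> t)) -` {(x, y). x = y} = S" by (auto simp: S_def)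
  ultimately have closed: "closedin (top_of_set K) S" by simp
  have "\<exists>e>0. ball s e \<inter> K \<subseteq> S" if s: "s \<in> S" for s
  proof -
    have sK: "s \<in> K" and eq: "\<delta> s = \<gamma> s" using s by (auto simp: S_def)
    obtain c where c: "c \<in> charts_at A (\<gamma> s)" using charts_at_nonempty by blast
    obtain F r L where F: "0 < r" "L-lipschitz_on (cball (snd c (\<gamma> s)) r) F"
        "\<forall>q\<in>fst c. snd c q \<in> cball (snd c (\<gamma> s)) r \<longrightarrow> X q c = F (snd c q)"
      by (rule lipschitz_fieldE[OF X c])
    have L0: "0 \<le> L" using F lipschitz_on_nonneg by blast
    obtain d1 where d1: "0 < d1"
        "\<forall>t\<in>K. dist t s < d1 \<longrightarrow> \<gamma> t \<in> fst c \<and> snd c (\<gamma> t) \<in> cball (snd c (\<gamma> s)) r"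
      using integral_path_in_chart_nbhd[OF \<gamma>K sK c F(1)] by blast
    obtain d2 where d2: "0 < d2"
        "\<forall>t\<in>K. dist t s < d2 \<longrightarrow> \<delta> t \<in> fst c \<and> snd c (\<delta> t) \<in> cball (snd c (\<gamma> s)) r"
      using integral_path_in_chart_nbhd[OF \<delta>K sK _ F(1), of c] c eq by auto
    define e where "e = min (min d1 d2) (1 / (2 * (L + 1)))"
    have e: "0 < e" using d1 d2 L0 by (simp add: e_def)
    have "L * e \<le> L * (1 / (2 * (L + 1)))" by (intro mult_left_mono L0) (simp add: e_def)
    also have "\<dots> \<le> 1/2" using L0 by (simp add: field_simps)
    finally have Le: "L * e \<le> 1/2" .
    define N where "N = ball s e \<inter> K"
    have N: "convex N" "s \<in> N" "N \<subseteq> cball s e"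
      using K sK e by (auto simp: N_def is_interval_convex intro!: convex_Int)
    have sol: "(snd c \<circ> \<sigma>) t \<in> cball (snd c (\<gamma> s)) r \<and>
        ((snd c \<circ> \<sigma>) has_vector_derivative F ((snd c \<circ> \<sigma>) t)) (at t within N)"
      if \<sigma>: "integral_path_on A X g K \<sigma>" and t: "t \<in> N"
        and in_c: "\<sigma> t \<in> fst c" "snd c (\<sigma> t) \<in> cball (snd c (\<gamma> s)) r" for \<sigma> t
    proof -
      have "c \<in> charts_at A (\<sigma> t)" using in_c chart(1)[OF c] by (simp add: charts_at_def)
      then have "((snd c \<circ> \<sigma>) has_vector_derivative X (\<sigma> t) c) (at t within K)"
        using \<sigma> t by (auto simp: integral_path_on_def N_def)
      then have "((snd c \<circ> \<sigma>) has_vector_derivative X (\<sigma> t) c) (at t within N)"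
        by (rule has_vector_derivative_within_subset) (simp add: N_def)
      then show ?thesis using F(3) in_c by auto
    qed
    have near: "\<gamma> t \<in> fst c" "snd c (\<gamma> t) \<in> cball (snd c (\<gamma> s)) r"
        "\<delta> t \<in> fst c" "snd c (\<delta> t) \<in> cball (snd c (\<gamma> s)) r" if "t \<in> N" for t
      using that d1(2) d2(2) by (auto simp: N_def e_def dist_commute)
    have "\<gamma> t = \<delta> t" if t: "t \<in> N" for t
    proof -
      have "(snd c \<circ> \<gamma>) t = (snd c \<circ> \<delta>) t"
        using ode_unique_local[OF F(2) bounded_cball N Le, of "snd c \<circ> \<gamma>" "snd c \<circ> \<delta>" t]
          sol[OF \<gamma>K] sol[OF \<delta>K] near eq t by simp
      then show ?thesis using near[OF t] chart(6)[OF c] by (auto dest: inj_onD)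
    qed
    then show ?thesis using e by (intro exI[of _ e]) (auto simp: N_def S_def)
  qed
  then have "openin (top_of_set K) S" by (auto simp: openin_contains_ball S_def)
  moreover have "connected K" using K by (simp add: is_interval_connected)
  moreover have "0 \<in> S" using \<gamma>' \<delta>' K by (simp add: S_def)
  ultimately have "S = K" using closed by (metis connected_clopen empty_iff)
  then show ?thesis using t by (auto simp: S_def K_def)
qed

lemma integral_path_eq:
  assumes X: "lipschitz_field H A X" and \<gamma>: "integral_path_on A X g I \<gamma>" "t \<in> I"
  shows "integral_path A X g t = \<gamma> t"
  unfolding integral_path_def
proof (rule the_equality)
  show "\<exists>I' \<gamma>'. integral_path_on A X g I' \<gamma>' \<and> t \<in> I' \<and> \<gamma>' t = \<gamma> t"
    using \<gamma> by blast
  show "y = \<gamma> t" if "\<exists>I' \<gamma>'. integral_path_on A X g I' \<gamma>' \<and> t \<in> I' \<and> \<gamma>' t = y" for y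
    using that integral_path_unique[OF X _ \<gamma>(1) _ \<gamma>(2)] by blast
qed

text \<open>
It suffices to solve the equation in one chart, since the components of a tangent vector
transform in the same way as velocities.
\<close>

lemma integral_path_from_chart:
  assumes X: "lipschitz_field H A X" and c: "c \<in> charts_at A p" and e: "0 \<le> e" and y0: "y 0 = snd c p"
    and y: "\<And>t. t \<in> {0..e} \<Longrightarrow> y t \<in> snd c ` fst c"
      "\<And>t. t \<in> {0..e} \<Longrightarrow>
        (y has_vector_derivative X (inv_into (fst c) (snd c) (y t)) c) (at t within {0..e})"
  shows "integral_path_on A X p {0..e} (\<lambda>t. inv_into (fst c) (snd c) (y t))"
proof -
  let ?\<gamma> = "\<lambda>t. inv_into (fst c) (snd c) (y t)"
  have "continuous_on {0..e} y"
    using y(2) has_vector_derivative_continuous by (force simp: continuous_on_eq_continuous_within)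
  then have cont: "continuous_on {0..e} ?\<gamma>"
    by (rule continuous_on_compose2[OF chart(7)[OF c]]) (use y in auto)
  have "((snd d \<circ> ?\<gamma>) has_vector_derivative X (?\<gamma> t) d) (at t within {0..e})"
    if t: "t \<in> {0..e}" and d: "d \<in> charts_at A (?\<gamma> t)" for t d
  proof -
    have c': "c \<in> charts_at A (?\<gamma> t)"
      using y(1)[OF t] chart(1)[OF c] by (simp add: charts_at_def inv_into_into)
    have "((snd c \<circ> ?\<gamma>) has_vector_derivative X (?\<gamma> t) c) (at t within {0..e})"
      by (rule has_vector_derivative_transform[OF t _ y(2)[OF t]]) (simp add: f_inv_into_f y(1))
    then have "((snd d \<circ> ?\<gamma>) has_vector_derivative
        frechet_derivative (coord_rep c d id) (at (snd c (?\<gamma> t)) within coord_dom c d id) (X (?\<gamma> t) c))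
        (at t within {0..e})"
      using curve_chart_change[OF c' d, of t "{0..e}" ?\<gamma>] cont t
      by (auto simp: continuous_on_eq_continuous_within)
    moreover have "X (?\<gamma> t) \<in> tangent_space H A (?\<gamma> t)" using X by (simp add: lipschitz_field_def)
    ultimately show ?thesis using tangent_spaceD(3)[OF _ c' d] by metis
  qed
  moreover have "?\<gamma> 0 = p" using y0 chart(2,6)[OF c] by simp
  ultimately show ?thesis
    unfolding integral_path_on_def using cont e by (simp add: is_interval_cc)
qed

end


section \<open>Local existence of integral paths\<close>

lemma boundary_pointsI:
  assumes "c \<in> charts_at A p" "snd c p \<in> rel_frontier H"
  shows "p \<in> boundary_points H A"
  using assms unfolding boundary_points_def charts_at_def by force

lemma inner_nondecreasing_along_solution:
  fixes y :: "real \<Rightarrow> 'a::real_inner"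
  assumes y: "\<And>t. t \<in> {0..e} \<Longrightarrow> (y has_vector_derivative y' t) (at t within {0..e})"
    and nonneg: "\<And>t. t \<in> {0..e} \<Longrightarrow> 0 \<le> y' t \<bullet> b" and t: "t \<in> {0..e}"
  shows "y 0 \<bullet> b \<le> y t \<bullet> b"
proof (cases "t = 0")
  case False
  then have "0 < t" using t by simp
  moreover have "((\<lambda>t. y t \<bullet> b) has_derivative (\<lambda>h. (h *\<^sub>R y' s) \<bullet> b)) (at s within {0..t})"
    if "s \<in> {0..t}" for s
  proof -
    have "(y has_derivative (\<lambda>h. h *\<^sub>R y' s)) (at s within {0..t})"
      using has_vector_derivative_within_subset[OF y, of s "{0..t}"] that t
      by (auto simp: has_vector_derivative_def)
    then show ?thesis by (rule has_derivative_inner_left)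
  qed
  ultimately obtain s where s: "s \<in> {0<..<t}" "y t \<bullet> b - y 0 \<bullet> b = ((t - 0) *\<^sub>R y' s) \<bullet> b"
    using mvt_simple[of 0 t "\<lambda>t. y t \<bullet> b" "\<lambda>s h. (h *\<^sub>R y' s) \<bullet> b"] by (auto simp: has_derivative_at_withinI)
  moreover have "0 \<le> t * (y' s \<bullet> b)" using s t nonneg[of s] by simp
  ultimately show ?thesis by simp
qed simp

context manifold_with_boundary
begin

text \<open>
Solutions of the extended equation in the ambient space exist by Picard--Lindeloef; the point is
that they do not leave the half-space. This is clear near an interior point. At a boundary point
with inward-pointing vector, the normal component of the field is positive nearby, so the normal
component of the solution increases. If the field is tangent to the boundary, composing it with the
orthogonal projection \<open>P\<close> onto the hyperplane gives a field without normal
component, whose solution stays in the hyperplane, where both fields agree.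
\<close>

lemma forward_path_exists:
  assumes X: "lipschitz_field H A X"
    and p: "p \<in> interior_points H A \<or> inward_pointing H A p (X p) \<or>
      p \<in> boundary_points H A \<and> (\<forall>q\<in>boundary_points H A. tangent_to_boundary H A q (X q))"
  shows "\<exists>e>0. \<exists>\<gamma>. integral_path_on A X p {0..e} \<gamma>"
  using model
proof (cases rule: model_space_cases)
  case point
  obtain c where c: "c \<in> charts_at A p" using charts_at_nonempty by blast
  have x0: "snd c p = 0" using chart(8)[OF c] point by simp
  have "X p c = 0"
    using X tangent_spaceD(1)[OF _ c, of "X p" H] point by (simp add: lipschitz_field_def)
  then have "integral_path_on A X p {0..1} (\<lambda>t. inv_into (fst c) (snd c) (snd c p))"
    by (intro integral_path_from_chart[OF X c])
      (use chart(2,6)[OF c] in \<open>auto intro!: derivative_eq_intros\<close>)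
  then show ?thesis by (intro exI[of _ 1]) auto
next
  case (half_space b)
  have "\<exists>c\<in>charts_at A p. 0 < snd c p \<bullet> b \<or> snd c p \<bullet> b = 0 \<and> (0 < X p c \<bullet> b \<or>
      (\<forall>q\<in>boundary_points H A. tangent_to_boundary H A q (X q)))"
    using p half_space
    by (auto simp: interior_points_def boundary_points_def charts_at_def inward_pointing_def)
      force+
  then obtain c where c: "c \<in> charts_at A p"
    and cases: "0 < snd c p \<bullet> b \<or> snd c p \<bullet> b = 0 \<and> (0 < X p c \<bullet> b \<or>
      (\<forall>q\<in>boundary_points H A. tangent_to_boundary H A q (X q)))" by blast
  define x where "x = snd c p"
  obtain F r L where F: "0 < r" "L-lipschitz_on (cball x r) F"
      "\<forall>q\<in>fst c. snd c q \<in> cball x r \<longrightarrow> X q c = F (snd c q)"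
    unfolding x_def by (rule lipschitz_fieldE[OF X c])
  obtain s where s: "0 < s" "H \<inter> cball x s \<subseteq> snd c ` fst c"
    using chart(4)[OF c] chart(2)[OF c] by (auto simp: openin_contains_cball Int_commute x_def)
  have inv: "inv_into (fst c) (snd c) u \<in> fst c" "snd c (inv_into (fst c) (snd c) u) = u"
    if "u \<in> H" "u \<in> cball x (min r s)" for u
  proof -
    have "u \<in> snd c ` fst c" using that s by auto
    then show "inv_into (fst c) (snd c) u \<in> fst c" "snd c (inv_into (fst c) (snd c) u) = u"
      by (auto simp: inv_into_into f_inv_into_f)
  qed
  have XF: "X (inv_into (fst c) (snd c) u) c = F u" if "u \<in> H" "u \<in> cball x (min r s)" for u
    using F(3) inv[OF that] that by auto
  \<comment> \<open>A modified field \<open>G\<close> may be solved instead of \<open>F\<close>, provided that its solutions stay in the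
    half-space and do not notice the modification.\<close>
  have solve: ?thesis
    if G: "K-lipschitz_on (cball x r') G" and r': "0 < r'" "r' \<le> r" "r' \<le> s"
      and stays: "\<And>e y t. \<lbrakk>y 0 = x; \<And>t. t \<in> {0..e} \<Longrightarrow> y t \<in> cball x r';
          \<And>t. t \<in> {0..e} \<Longrightarrow> (y has_vector_derivative G (y t)) (at t within {0..e}); t \<in> {0..e}\<rbrakk>
        \<Longrightarrow> y t \<in> H \<and> G (y t) = F (y t)" for G K r'
  proof -
    obtain e y where e: "0 < e" and y0: "y 0 = x"
      and y: "\<And>t. t \<in> {0..e} \<Longrightarrow> y t \<in> cball x r'"
        "\<And>t. t \<in> {0..e} \<Longrightarrow> (y has_vector_derivative G (y t)) (at t within {0..e})"
      using picard_local[OF G r'(1)] by blast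
    have yH: "y t \<in> H" "G (y t) = F (y t)" "y t \<in> cball x (min r s)" if "t \<in> {0..e}" for t
      using stays[OF y0 y that] y(1)[OF that] r' by auto
    have "integral_path_on A X p {0..e} (\<lambda>t. inv_into (fst c) (snd c) (y t))"
    proof (rule integral_path_from_chart[OF X c])
      fix t assume t: "t \<in> {0..e}"
      show "y t \<in> snd c ` fst c" using yH[OF t] s by auto
      show "(y has_vector_derivative X (inv_into (fst c) (snd c) (y t)) c) (at t within {0..e})"
        using y(2)[OF t] XF[of "y t"] yH[OF t] by simp
    qed (use e y0 x_def in auto)
    then show ?thesis using e by blast
  qed
  consider (interior) "0 < x \<bullet> b" | (inward) "x \<bullet> b = 0" "0 < X p c \<bullet> b"
    | (tangent) "x \<bullet> b = 0" "\<forall>q\<in>boundary_points H A. tangent_to_boundary H A q (X q)"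
    using cases x_def by blast
  then show ?thesis
  proof cases
    case interior
    have "open {u. 0 < u \<bullet> b}" using open_halfspace_gt[of 0 b] by (simp add: inner_commute)
    then obtain s' where s': "0 < s'" "cball x s' \<subseteq> {u. 0 < u \<bullet> b}"
      using interior open_contains_cball by blast
    let ?r = "min s' (min r s)"
    show ?thesis
    proof (rule solve)
      show "L-lipschitz_on (cball x ?r) F" using F(2) by (rule lipschitz_on_subset) auto
      show "y t \<in> H \<and> F (y t) = F (y t)"
        if "\<And>t. t \<in> {0..e} \<Longrightarrow> y t \<in> cball x ?r" "t \<in> {0..e}" for e y t
        using that(1)[OF that(2)] s'(2) half_space(2) by force
    qed (use F s s' in auto)
  next
    case inward
    have "x \<in> H" "x \<in> cball x (min r s)" using chart(8)[OF c] F s by (auto simp: x_def)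
    then have "0 < F x \<bullet> b"
      using XF[of x] inward chart(2,6)[OF c] by (auto simp: x_def)
    moreover have "continuous_on (ball x r) (\<lambda>u. F u \<bullet> b)"
      using lipschitz_on_continuous_on[OF F(2)] by (intro continuous_intros) (auto intro: continuous_on_subset)
    then have "open (ball x r \<inter> (\<lambda>u. F u \<bullet> b) -` {0<..})"
      by (intro continuous_open_preimage) auto
    ultimately obtain s' where s': "0 < s'" "cball x s' \<subseteq> ball x r \<inter> (\<lambda>u. F u \<bullet> b) -` {0<..}"
      using F(1) open_contains_cball[of "ball x r \<inter> (\<lambda>u. F u \<bullet> b) -` {0<..}"] by force
    let ?r = "min s' (min r s)"
    show ?thesis
    proof (rule solve)
      show "L-lipschitz_on (cball x ?r) F" using F(2) by (rule lipschitz_on_subset) auto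
      show "y t \<in> H \<and> F (y t) = F (y t)"
        if y0: "y 0 = x" and y: "\<And>t. t \<in> {0..e} \<Longrightarrow> y t \<in> cball x ?r"
          "\<And>t. t \<in> {0..e} \<Longrightarrow> (y has_vector_derivative F (y t)) (at t within {0..e})"
          and t: "t \<in> {0..e}" for e y t
      proof -
        have "0 \<le> F (y t) \<bullet> b" if "t \<in> {0..e}" for t
          using y(1)[OF that] s'(2) by force
        from inner_nondecreasing_along_solution[OF y(2) this t] show ?thesis
          using inward y0 half_space(2) by simp
      qed
    qed (use F s s' in auto)
  next
    case tangent
    define P where "P = (\<lambda>u. u - (u \<bullet> b) *\<^sub>R b)"
    have Pb: "P u \<bullet> b = 0" for u using half_space by (simp add: P_def inner_diff_left)
    have Px: "P x = x" using tangent by (simp add: P_def)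
    have P_dist: "dist (P u) (P v) \<le> dist u v" for u v
    proof -
      have "P u - P v = P (u - v)" by (simp add: P_def algebra_simps inner_diff_left)
      moreover have "(norm (P w))\<^sup>2 = (norm w)\<^sup>2 - (w \<bullet> b)\<^sup>2" for w
        unfolding power2_norm_eq_inner using half_space(1)
        by (simp add: P_def inner_diff_left inner_diff_right inner_commute power2_eq_square)
      then have "(norm (P w))\<^sup>2 \<le> (norm w)\<^sup>2" for w by simp
      then have "norm (P w) \<le> norm w" for w using power2_le_imp_le norm_ge_zero by blast
      ultimately show ?thesis by (simp add: dist_norm)
    qed
    let ?r = "min r s"
    have P_ball: "P u \<in> cball x \<rho>" if "u \<in> cball x \<rho>" for u \<rho>
      using P_dist[of x u] that Px by simp
    have FP: "F (P u) \<bullet> b = 0" if u: "u \<in> cball x ?r" for u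
    proof -
      let ?q = "inv_into (fst c) (snd c) (P u)"
      have PH: "P u \<in> H" "P u \<in> cball x ?r" using Pb half_space P_ball[OF u] by auto
      have "c \<in> charts_at A ?q" using inv(1)[OF PH] chart(1)[OF c] by (simp add: charts_at_def)
      moreover have "snd c ?q \<in> rel_frontier H" using inv(2)[OF PH] Pb half_space by simp
      ultimately have "?q \<in> boundary_points H A"
        by (rule boundary_pointsI)
      then have "X ?q c \<in> rel_frontier H"
        using tangent \<open>c \<in> charts_at A ?q\<close> by (simp add: tangent_to_boundary_def)
      then show ?thesis using XF[OF PH] half_space by simp
    qed
    show ?thesis
    proof (rule solve)
      show "L-lipschitz_on (cball x ?r) (F \<circ> P)"
      proof (rule lipschitz_onI)
        fix u v assume uv: "u \<in> cball x ?r" "v \<in> cball x ?r"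
        have "dist (F (P u)) (F (P v)) \<le> L * dist (P u) (P v)"
          using P_ball[OF uv(1)] P_ball[OF uv(2)] by (intro lipschitz_onD[OF F(2)]) auto
        also have "\<dots> \<le> L * dist u v"
          by (intro mult_left_mono P_dist lipschitz_on_nonneg[OF F(2)])
        finally show "dist ((F \<circ> P) u) ((F \<circ> P) v) \<le> L * dist u v" by simp
      qed (rule lipschitz_on_nonneg[OF F(2)])
      show "y t \<in> H \<and> (F \<circ> P) (y t) = F (y t)"
        if y0: "y 0 = x" and y: "\<And>t. t \<in> {0..e} \<Longrightarrow> y t \<in> cball x ?r"
          "\<And>t. t \<in> {0..e} \<Longrightarrow> (y has_vector_derivative (F \<circ> P) (y t)) (at t within {0..e})"
          and t: "t \<in> {0..e}" for e y t
      proof -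
        have z: "(F \<circ> P) (y t) \<bullet> b = 0" if "t \<in> {0..e}" for t
          using FP[OF y(1)[OF that]] by simp
        have "y 0 \<bullet> b \<le> y t \<bullet> b"
          by (rule inner_nondecreasing_along_solution[OF y(2) _ t]) (use z in auto)
        moreover have "y 0 \<bullet> - b \<le> y t \<bullet> - b"
          by (rule inner_nondecreasing_along_solution[OF y(2) _ t]) (use z in auto)
        ultimately have "y t \<bullet> b = 0" using tangent y0 by simp
        then show ?thesis using half_space(2) by (simp add: P_def)
      qed
    qed (use F s in auto)
  qed
qed

text \<open>
A path that starts on the boundary and lives for some positive time has a nonnegative normal
component there, which vanishes at time \<open>0\<close>; hence its one-sided derivative is nonnegative.
\<close>

lemma forward_path_at_boundary_inner_nonneg:
  assumes \<gamma>: "integral_path_on A X p I \<gamma>" and t: "t \<in> I" "0 < t"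
    and c: "c \<in> charts_at A p" and p: "p \<in> boundary_points H A"
    and b: "H = {x. 0 \<le> x \<bullet> b}" "rel_frontier H = {x. x \<bullet> b = 0}"
  shows "0 \<le> X p c \<bullet> b"
proof (rule ccontr)
  assume "\<not> 0 \<le> X p c \<bullet> b"
  then have neg: "X p c \<bullet> b < 0" by simp
  note \<gamma>' = \<gamma>[unfolded integral_path_on_def]
  have \<gamma>0: "\<gamma> 0 = p" "0 \<in> I" using \<gamma>' by auto
  have "((snd c \<circ> \<gamma>) has_vector_derivative X p c) (at 0 within I)" using \<gamma>' c by metis
  then have "((\<lambda>t. (snd c \<circ> \<gamma>) t \<bullet> b) has_derivative (\<lambda>h. (h *\<^sub>R X p c) \<bullet> b)) (at 0 within I)"
    unfolding has_vector_derivative_def by (rule has_derivative_inner_left)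
  then have "((\<lambda>t. (snd c \<circ> \<gamma>) t \<bullet> b) has_real_derivative X p c \<bullet> b) (at 0 within I)"
    by (simp add: has_field_derivative_def mult_commute_abs)
  from has_real_derivative_neg_dec_right[OF this neg] obtain d where d: "0 < d"
    "\<And>h. 0 < h \<Longrightarrow> h \<in> I \<Longrightarrow> h < d \<Longrightarrow> snd c (\<gamma> h) \<bullet> b < snd c p \<bullet> b"
    using \<gamma>0 by auto
  obtain d' where d': "0 < d'" "\<And>h. h \<in> I \<Longrightarrow> dist h 0 < d' \<Longrightarrow> \<gamma> h \<in> fst c"
    using integral_path_in_chart_nbhd[OF \<gamma> \<gamma>0(2), of c 1] c \<gamma>0 by auto
  define h where "h = min t (min d d' / 2)"
  have h: "0 < h" "h \<le> t" "h < d" "h < d'" using t d d' by (auto simp: h_def)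
  have "h \<in> I" using \<gamma>' t h \<gamma>0(2) by (meson is_interval_1 less_imp_le)
  then have "snd c (\<gamma> h) \<bullet> b < 0"
    using d(2)[OF h(1) _ h(3)] boundary_in_every_chart[OF p c] b by simp
  moreover have "snd c (\<gamma> h) \<in> H"
    using d'(2)[OF \<open>h \<in> I\<close>] h chart(4)[OF c] openin_imp_subset by fastforce
  ultimately show False using b by simp
qed

end

section \<open>Left translations of integral paths\<close>

text \<open>
In charts, left translation by \<open>g\<close> is multiplication with its first argument frozen at the
coordinates of \<open>g\<close>.
\<close>

lemma left_translation_differentiable:
  fixes A :: "('m::{monoid_mult, t2_space, second_countable_topology}, 'e::euclidean_space) chart set"
  assumes M: "lie_monoid H A"
    and c: "c \<in> charts_at A h" and d: "d \<in> charts_at A (g * h)"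
  shows "coord_rep c d (left_translation g) differentiable
    (at (snd c h) within coord_dom c d (left_translation g))"
proof -
  interpret manifold_with_boundary H A
    using M by unfold_locales (simp add: lie_monoid_def)
  obtain c' where c': "c' \<in> charts_at A g" using charts_at_nonempty by blast
  let ?P = "(fst c' \<times> fst c, map_prod (snd c') (snd c))" and ?m = "\<lambda>(g, h). g * h :: 'm"
  have "?P \<in> prod_atlas A A"
    using chart(1)[OF c] chart(1)[OF c'] by (cases c; cases c') (auto simp: prod_atlas_def)
  then have "smooth_on (coord_dom ?P d ?m) (coord_rep ?P d ?m)"
    using M chart(1)[OF d] by (simp add: lie_monoid_def smooth_map_def)
  moreover have "(snd c' g, snd c h) \<in> coord_dom ?P d ?m"
    using chart(2)[OF c] chart(2)[OF c'] chart(2)[OF d] by (force simp: coord_dom_eq)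
  ultimately have "coord_rep ?P d ?m differentiable (at (snd c' g, snd c h) within coord_dom ?P d ?m)"
    by (rule smooth_on_imp_differentiable_within)
  then obtain D where D: "(coord_rep ?P d ?m has_derivative D)
      (at (snd c' g, snd c h) within coord_dom ?P d ?m)" by (auto simp: differentiable_def)
  let ?S = "coord_dom c d (left_translation g)"
  have S: "(snd c' g, x) \<in> coord_dom ?P d ?m" if "x \<in> ?S" for x
    using that chart(2)[OF c'] by (force simp: coord_dom_eq left_translation_def)
  have "((\<lambda>x. (snd c' g, x)) has_derivative (\<lambda>v. (0, v))) (at (snd c h) within ?S)"
    by (auto intro!: derivative_eq_intros)
  moreover have "(coord_rep ?P d ?m has_derivative D)
      (at (snd c' g, snd c h) within (\<lambda>x. (snd c' g, x)) ` ?S)"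
    using D by (rule has_derivative_subset) (use S in auto)
  ultimately have "((\<lambda>x. coord_rep ?P d ?m (snd c' g, x)) has_derivative (\<lambda>v. D (0, v)))
      (at (snd c h) within ?S)"
    by (rule has_derivative_in_compose)
  moreover have "coord_rep ?P d ?m (snd c' g, x) = coord_rep c d (left_translation g) x" if x: "x \<in> ?S" for x
  proof -
    obtain q where q: "q \<in> fst c" "x = snd c q" using x by (auto simp: coord_dom_eq)
    have "inj_on (map_prod (snd c') (snd c)) (fst c' \<times> fst c)"
      using chart(6)[OF c] chart(6)[OF c'] by (rule map_prod_inj_on[rotated])
    moreover have "(snd c' g, x) = map_prod (snd c') (snd c) (g, q)" using q by simp
    ultimately have "inv_into (fst c' \<times> fst c) (map_prod (snd c') (snd c)) (snd c' g, x) = (g, q)"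
      using q chart(2)[OF c'] by (metis inv_into_f_f mem_Sigma_iff)
    then show ?thesis using q chart(6)[OF c] by (simp add: coord_rep_eq left_translation_def)
  qed
  moreover have "snd c h \<in> ?S"
    using chart(2)[OF c] chart(2)[OF d] by (auto simp: coord_dom_eq left_translation_def)
  ultimately have "(coord_rep c d (left_translation g) has_derivative (\<lambda>v. D (0, v)))
      (at (snd c h) within ?S)"
    by (metis (no_types, lifting) has_derivative_transform)
  then show ?thesis by (auto simp: differentiable_def)
qed

lemma continuous_on_left_translation:
  fixes A :: "('m::{monoid_mult, t2_space, second_countable_topology}, 'e::euclidean_space) chart set"
  assumes "lie_monoid H A"
  shows "continuous_on S (left_translation (g :: 'm))"
proof -
  have "continuous_on UNIV (\<lambda>(g, h). g * h :: 'm)"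
    using assms by (auto simp: lie_monoid_def smooth_map_def)
  then have "continuous_on S (\<lambda>h. (\<lambda>(g, h). g * h) (g, h))"
    by (rule continuous_on_compose2) (auto intro!: continuous_intros)
  then show ?thesis by (simp add: left_translation_def[abs_def])
qed

text \<open>
Left invariance in terms of curves. The velocity is assumed in all charts
around \<open>h\<close> because \<^const>\<open>differential\<close> is computed in a chart chosen arbitrarily.
\<close>

lemma curve_left_translation:
  assumes M: "lie_monoid H A" and X: "left_invariant A X"
    and \<gamma>: "continuous (at t within I) \<gamma>" "t \<in> I" "\<gamma> t = h"
    and v: "\<And>c. c \<in> charts_at A h \<Longrightarrow> ((snd c \<circ> \<gamma>) has_vector_derivative X h c) (at t within I)"
    and d: "d \<in> charts_at A (g * h)"
  shows "((snd d \<circ> (\<lambda>t. g * \<gamma> t)) has_vector_derivative X (g * h) d) (at t within I)"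
proof -
  interpret manifold_with_boundary H A
    using M by unfold_locales (simp add: lie_monoid_def)
  define c where "c = (SOME c. c \<in> charts_at A h)"
  have c: "c \<in> charts_at A h" unfolding c_def using charts_at_nonempty by (rule someI_ex)
  have "X (g * h) d = differential A A (left_translation g) h (X h) d"
    using X by (simp add: left_invariant_def)
  also have "\<dots> = frechet_derivative (coord_rep c d (left_translation g))
      (at (snd c h) within coord_dom c d (left_translation g)) (X h c)"
    using d by (simp add: differential_def c_def[symmetric] Let_def left_translation_def)
  finally have "X (g * h) d = \<dots>" .
  moreover have "left_translation g h \<in> fst d" using chart(2)[OF d] by (simp add: left_translation_def)
  ultimately show ?thesis
    using curve_derivative_chain[of h c "left_translation g" d t I \<gamma> "X h c"]
      chart(2,3,6)[OF c] chart(3)[OF d] continuous_on_left_translation[OF M, of UNIV g]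
      left_translation_differentiable[OF M c d] \<gamma> v[OF c]
    by (simp add: left_translation_def o_def)
qed

text \<open>
This is the heart of the matter: left translates of integral paths of a left-invariant field are again integral
paths. Applied to the path from the unit, it gives paths from all points with the same
domain.
\<close>

lemma integral_path_left_translation:
  assumes M: "lie_monoid H A" and X: "left_invariant A X"
    and \<gamma>: "integral_path_on A X h I \<gamma>"
  shows "integral_path_on A X (g * h) I (\<lambda>t. g * \<gamma> t)"
proof -
  note \<gamma>' = \<gamma>[unfolded integral_path_on_def]
  have "continuous_on I (\<lambda>t. left_translation g (\<gamma> t))"
    by (rule continuous_on_compose2[OF continuous_on_left_translation[OF M, of UNIV]]) (use \<gamma>' in auto)
  then have "continuous_on I (\<lambda>t. g * \<gamma> t)" by (simp add: left_translation_def)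
  moreover have "((snd d \<circ> (\<lambda>t. g * \<gamma> t)) has_vector_derivative X (g * \<gamma> t) d) (at t within I)"
    if t: "t \<in> I" and d: "d \<in> charts_at A (g * \<gamma> t)" for t d
  proof (rule curve_left_translation[where \<gamma> = \<gamma> and h = "\<gamma> t", OF M X _ t refl _ d])
    show "continuous (at t within I) \<gamma>" using \<gamma>' t by (simp add: continuous_on_eq_continuous_within)
    show "((snd c \<circ> \<gamma>) has_vector_derivative X (\<gamma> t) c) (at t within I)" if "c \<in> charts_at A (\<gamma> t)" for c
      using \<gamma>' t that by blast
  qed
  ultimately show ?thesis unfolding integral_path_on_def using \<gamma>' by simp
qed

text \<open>
The field at a boundary point \<open>g\<close> is the velocity of \<open>g * \<gamma>\<close>, where \<open>\<gamma>\<close> is any curve through the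
unit with velocity \<open>X 1\<close>. Choosing \<open>\<gamma>\<close> inside the boundary is possible by tangency at the
unit, and then \<open>g * \<gamma>\<close> stays in the boundary because the boundary is a submonoid.
\<close>

lemma tangent_at_unit_imp_tangent_to_boundary:
  assumes M: "lie_monoid H A" and X: "left_invariant A X" and X1: "X 1 \<in> tangent_space H A 1"
    and submonoid: "\<And>g h. g \<in> boundary_points H A \<Longrightarrow> h \<in> boundary_points H A \<Longrightarrow> g * h \<in> boundary_points H A"
    and tangent: "tangent_to_boundary H A 1 (X 1)" and g: "g \<in> boundary_points H A"
  shows "tangent_to_boundary H A g (X g)"
proof -
  interpret manifold_with_boundary H A
    using M by unfold_locales (simp add: lie_monoid_def)
  have one: "1 \<in> boundary_points H A" using tangent by (simp add: tangent_to_boundary_def)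
  have "X g d \<in> rel_frontier H" if d: "d \<in> charts_at A g" for d
    using model
  proof (cases rule: model_space_cases)
    case point
    then show ?thesis using boundary_in_every_chart[OF g d] by simp
  next
    case (half_space b)
    obtain c where c: "c \<in> charts_at A 1" using charts_at_nonempty by blast
    define v where "v = X 1 c"
    have vb: "v \<bullet> b = 0" using tangent c half_space by (auto simp: tangent_to_boundary_def v_def)
    have xb: "snd c 1 \<bullet> b = 0" using boundary_in_every_chart[OF one c] half_space by simp
    obtain s where s: "0 < s" "H \<inter> cball (snd c 1) s \<subseteq> snd c ` fst c"
      using chart(4)[OF c] chart(2)[OF c] by (auto simp: openin_contains_cball Int_commute)
    \<comment> \<open>The segment \<open>snd c 1 + t v\<close> with \<open>t \<le> e\<close> has length at most \<open>s\<close>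
      and lies in the hyperplane, so it stays in the image of the chart.\<close>
    define e where "e = s / (norm v + 1)"
    have n: "0 < norm v + 1" by (simp add: add_nonneg_pos)
    have e: "0 < e" "e * norm v \<le> s"
      using s n by (auto simp: e_def field_simps)
    have im: "snd c 1 + t *\<^sub>R v \<in> snd c ` fst c" if t: "t \<in> {0..e}" for t
    proof -
      have "t * norm v \<le> e * norm v" using t by (intro mult_right_mono) auto
      then have "snd c 1 + t *\<^sub>R v \<in> H \<inter> cball (snd c 1) s"
        using t e vb xb half_space by (auto simp: dist_norm inner_add_left)
      then show ?thesis using s by blast
    qed
    have z: "0 \<in> {0..e}" using e by simp
    define \<gamma> where "\<gamma> = (\<lambda>t. inv_into (fst c) (snd c) (snd c 1 + t *\<^sub>R v))"
    have \<gamma>0: "\<gamma> 0 = 1" unfolding \<gamma>_def by (rule chart_line_curve(1)[OF c z im])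
    have "continuous_on {0..e} \<gamma>" unfolding \<gamma>_def by (rule chart_line_curve(2)[OF c z im])
    then have \<gamma>c: "continuous (at 0 within {0..e}) \<gamma>" using z by (simp add: continuous_on_eq_continuous_within)
    have \<gamma>d: "((snd c \<circ> \<gamma>) has_vector_derivative v) (at 0 within {0..e})"
      unfolding \<gamma>_def by (rule chart_line_curve(3)[OF c z im z])
    have "((snd c' \<circ> \<gamma>) has_vector_derivative X 1 c') (at 0 within {0..e})"
      if c': "c' \<in> charts_at A 1" for c'
      using curve_chart_change[OF c c' \<gamma>c z \<gamma>0 \<gamma>d] tangent_spaceD(3)[OF X1 c c'] by (simp add: v_def)
    then have "((snd d \<circ> (\<lambda>t. g * \<gamma> t)) has_vector_derivative X (g * 1) d) (at 0 within {0..e})"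
      using d by (intro curve_left_translation[OF M X \<gamma>c z \<gamma>0]) auto
    then have D: "((\<lambda>t. (snd d \<circ> (\<lambda>t. g * \<gamma> t)) t \<bullet> b) has_derivative (\<lambda>h. (h *\<^sub>R X g d) \<bullet> b)) (at 0 within {0..e})"
      unfolding has_vector_derivative_def mult_1_right by (rule has_derivative_inner_left)
    have gc: "continuous (at 0 within {0..e}) (\<lambda>t. g * \<gamma> t)"
    proof -
      have "continuous_on {0..e} (\<lambda>t. left_translation g (\<gamma> t))"
        by (rule continuous_on_compose2[OF continuous_on_left_translation[OF M, of UNIV]
              \<open>continuous_on {0..e} \<gamma>\<close>]) auto
      then show ?thesis using z by (simp add: continuous_on_eq_continuous_within left_translation_def)
    qed
    then obtain U where U: "open U" "0 \<in> U" "\<And>t. t \<in> {0..e} \<Longrightarrow> t \<in> U \<Longrightarrow> g * \<gamma> t \<in> fst d"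
      unfolding continuous_within_topological using chart(2,3)[OF d] \<gamma>0
      by (metis mult_1_right)
    have zero: "snd d (g * \<gamma> t) \<bullet> b = 0" if t: "t \<in> {0..e}" "t \<in> U" for t
    proof -
      have "\<gamma> t \<in> fst c" unfolding \<gamma>_def using im[OF t(1)] by (rule inv_into_into)
      moreover have "snd c (\<gamma> t) = snd c 1 + t *\<^sub>R v"
        unfolding \<gamma>_def using im[OF t(1)] by (rule f_inv_into_f)
      ultimately have "\<gamma> t \<in> boundary_points H A"
        using chart(1)[OF c] vb xb half_space
        by (intro boundary_pointsI[of c]) (auto simp: charts_at_def inner_add_left)
      then have "g * \<gamma> t \<in> boundary_points H A" by (rule submonoid[OF g])
      moreover have "d \<in> charts_at A (g * \<gamma> t)"
        using U(3)[OF t] chart(1)[OF d] by (simp add: charts_at_def)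
      ultimately show ?thesis using boundary_in_every_chart half_space by blast
    qed
    obtain \<rho> where \<rho>: "0 < \<rho>" "ball 0 \<rho> \<subseteq> U" using U open_contains_ball by blast
    have "((\<lambda>t. 0::real) has_derivative (\<lambda>h. (h *\<^sub>R X g d) \<bullet> b)) (at 0 within {0..e})"
    proof (rule has_derivative_transform_within[OF D \<rho>(1) z])
      fix t assume "t \<in> {0..e}" "dist t 0 < \<rho>"
      moreover from this have "t \<in> U" using \<rho>(2) by (auto simp: dist_commute subset_iff)
      ultimately show "(snd d \<circ> (\<lambda>t. g * \<gamma> t)) t \<bullet> b = 0" using zero by simp
    qed
    then have "((\<lambda>t. 0::real) has_vector_derivative X g d \<bullet> b) (at 0 within {0..e})"
      by (simp add: has_vector_derivative_def)
    then have "X g d \<bullet> b = 0"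
      using vector_derivative_unique_within_closed_interval[of 0 e 0 "\<lambda>t. 0::real" "X g d \<bullet> b" 0] e
      by (auto simp: cbox_interval)
    then show ?thesis using half_space by simp
  qed
  then show ?thesis using g by (simp add: tangent_to_boundary_def)
qed

section \<open>Completeness of left-invariant vector fields\<close>

lemma left_translate_of_path_from_unit:
  assumes M: "lie_monoid H A" and X: "left_invariant A X" and \<gamma>: "integral_path_on A X 1 I \<gamma>"
  shows "integral_path_on A X g I (\<lambda>t. g * \<gamma> t)"
  using integral_path_left_translation[OF M X \<gamma>, of g] by simp

lemma path_from_unit_imp_forward_complete:
  assumes M: "lie_monoid H A" and X: "left_invariant A X"
    and \<gamma>: "integral_path_on A X 1 {0..e} \<gamma>" "0 < e"
  shows "{0..} \<subseteq> path_domain A X g"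
proof (rule uniform_forward_time_imp_forward_complete[OF \<gamma>(2)])
  show "\<exists>\<delta>. integral_path_on A X h {0..e} \<delta>" for h
    using left_translate_of_path_from_unit[OF M X \<gamma>(1), of h] by blast
qed

text \<open>
Left translation is available for paths of \<open>X\<close>, so the given path of \<open>-X\<close> is reversed,
translated, and reversed again before it is prolonged.
\<close>

lemma path_to_unit_imp_backward_complete:
  assumes M: "lie_monoid H A" and X: "left_invariant A X"
    and \<gamma>: "integral_path_on A (\<lambda>p c. - X p c) 1 {0..e} \<gamma>" "0 < e"
  shows "{..0} \<subseteq> path_domain A X g"
proof -
  have "integral_path_on A X 1 (uminus ` {0..e}) (\<lambda>t. \<gamma> (- t))"
    using integral_path_on_uminus[OF \<gamma>(1)] by simp
  then have "integral_path_on A X g (uminus ` {0..e}) (\<lambda>t. g * \<gamma> (- t))" for g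
    by (rule left_translate_of_path_from_unit[OF M X])
  from integral_path_on_uminus[OF this]
  have "integral_path_on A (\<lambda>p c. - X p c) g {0..e} (\<lambda>t. g * \<gamma> (- (- t)))" for g
    by (simp add: image_image)
  then have "{0..} \<subseteq> path_domain A (\<lambda>p c. - X p c) g"
    by (intro uniform_forward_time_imp_forward_complete[OF \<gamma>(2)] exI)
  then have "uminus ` {0..} \<subseteq> uminus ` uminus ` path_domain A X g"
    unfolding path_domain_uminus by (rule image_mono)
  then show ?thesis by (simp add: image_image)
qed

text \<open>
A path defined at a negative time would, after time reversal, force \<open>-X\<close> to have a
nonnegative normal component as well.
\<close>

lemma (in manifold_with_boundary) path_domain_of_inward_pointing:
  assumes p: "inward_pointing H A p (X p)" and fwd: "{0..} \<subseteq> path_domain A X p"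
  shows "path_domain A X p = {0..}"
proof
  show "path_domain A X p \<subseteq> {0..}"
  proof
    fix t assume "t \<in> path_domain A X p"
    then obtain I \<gamma> where \<gamma>: "integral_path_on A X p I \<gamma>" "t \<in> I"
      by (auto simp: path_domain_def)
    have bdry: "p \<in> boundary_points H A" using p by (simp add: inward_pointing_def)
    obtain c where c: "c \<in> charts_at A p" using charts_at_nonempty by blast
    show "t \<in> {0..}"
      using model
    proof (cases rule: model_space_cases)
      case point
      then show ?thesis using boundary_in_every_chart[OF bdry c] by simp
    next
      case (half_space b)
      show ?thesis
      proof (rule ccontr)
        assume "t \<notin> {0..}"
        then have "0 \<le> - X p c \<bullet> b"
          using forward_path_at_boundary_inner_nonneg[OF integral_path_on_uminus[OF \<gamma>(1)], of "- t"]
            \<gamma>(2) c bdry half_space(2,4) by auto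
        moreover have "0 < X p c \<bullet> b" using p c half_space by (auto simp: inward_pointing_def)
        ultimately show False by simp
      qed
    qed
  qed
qed (rule fwd)

text \<open>
A path through a boundary point that can be followed in both directions has both \<open>X \<bullet> b \<ge> 0\<close> and
\<open>-X \<bullet> b \<ge> 0\<close>.
\<close>

lemma (in manifold_with_boundary) complete_imp_tangent_to_boundary:
  assumes X: "complete_field A X" and p: "p \<in> boundary_points H A"
  shows "tangent_to_boundary H A p (X p)"
proof -
  have "X p c \<in> rel_frontier H" if c: "c \<in> charts_at A p" for c
    using model
  proof (cases rule: model_space_cases)
    case point
    then show ?thesis using boundary_in_every_chart[OF p c] by simp
  next
    case (half_space b)
    have dom: "t \<in> path_domain A X p" for t using X by (simp add: complete_field_def)
    obtain I \<gamma> where \<gamma>: "integral_path_on A X p I \<gamma>" "1 \<in> I"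
      using dom[of 1] by (auto simp: path_domain_def)
    obtain J \<delta> where \<delta>: "integral_path_on A X p J \<delta>" "- 1 \<in> J"
      using dom[of "- 1"] by (auto simp: path_domain_def)
    have "0 \<le> X p c \<bullet> b"
      by (rule forward_path_at_boundary_inner_nonneg[OF \<gamma> zero_less_one c p half_space(2,4)])
    moreover have "1 \<in> uminus ` J" using imageI[OF \<delta>(2), of uminus] by simp
    then have "0 \<le> - X p c \<bullet> b"
      by (rule forward_path_at_boundary_inner_nonneg[OF integral_path_on_uminus[OF \<delta>(1)] _
            zero_less_one c p half_space(2,4)])
    ultimately show ?thesis unfolding half_space(4) by simp
  qed
  then show ?thesis using p by (simp add: tangent_to_boundary_def)
qed

lemma inward_pointing_uminus:
  "inward_pointing H A p (\<lambda>c. - v c) \<longleftrightarrow> outward_pointing H A p v"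
  unfolding inward_pointing_def outward_pointing_def ..

lemma (in manifold_with_boundary) tangent_to_boundary_uminus:
  assumes "tangent_to_boundary H A p v"
  shows "tangent_to_boundary H A p (\<lambda>c. - v c)"
proof -
  have "- u \<in> rel_frontier H" if "u \<in> rel_frontier H" for u
    using model
  proof (cases rule: model_space_cases)
    case (half_space b)
    show ?thesis using that unfolding half_space(4) by simp
  qed (use that in simp)
  then show ?thesis using assms by (simp add: tangent_to_boundary_def)
qed

theorem theorem1p55:
  fixes H :: "'e::euclidean_space set"
    and A :: "('m::{monoid_mult, t2_space, second_countable_topology}, 'e) chart set"
    and X :: "'m \<Rightarrow> ('m, 'e) tvec"
  assumes "lie_monoid H A"
    and "normal_boundary H A"
    and "vector_field H A X"
    and "left_invariant A X"
  shows "(1 \<in> interior_points H A \<or>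
            1 \<in> boundary_points H A \<and> tangent_to_boundary H A 1 (X 1) \<longrightarrow>
          (\<forall>p\<in>boundary_points H A. tangent_to_boundary H A p (X p)) \<and> complete_field A X) \<and>
         (1 \<in> boundary_points H A \<and> inward_pointing H A 1 (X 1) \<longrightarrow>
          path_domain A X 1 = {0..} \<and> half_complete_field A X) \<and>
         (1 \<in> boundary_points H A \<and> outward_pointing H A 1 (X 1) \<longrightarrow>
          path_domain A X 1 = {..0} \<and> half_complete_field A X) \<and>
         (\<forall>t\<in>path_domain A X 1.
            (\<forall>g. t \<in> path_domain A X g) \<and> flow A X t = right_translation (flow A X t 1))"
proof -
  note M = assms(1) and inv = assms(4)
  interpret manifold_with_boundary H A
    using M by unfold_locales (simp add: lie_monoid_def)
  have X: "lipschitz_field H A X" using assms(3) by (rule vector_field_imp_lipschitz_field)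
  let ?N = "\<lambda>p c. - X p c"
  have N: "lipschitz_field H A ?N" using X by (rule lipschitz_field_uminus)
  have forward: "{0..} \<subseteq> path_domain A X g"
    if "1 \<in> interior_points H A \<or> inward_pointing H A 1 (X 1) \<or>
      1 \<in> boundary_points H A \<and> (\<forall>q\<in>boundary_points H A. tangent_to_boundary H A q (X q))" for g
    using forward_path_exists[OF X that] path_from_unit_imp_forward_complete[OF M inv] by blast
  have backward: "{..0} \<subseteq> path_domain A X g"
    if "1 \<in> interior_points H A \<or> inward_pointing H A 1 (?N 1) \<or>
      1 \<in> boundary_points H A \<and> (\<forall>q\<in>boundary_points H A. tangent_to_boundary H A q (?N q))" for g
    using forward_path_exists[OF N that] path_to_unit_imp_backward_complete[OF M inv] by blast
  have complete: "complete_field A X"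
    if *: "1 \<in> interior_points H A \<or> 1 \<in> boundary_points H A \<and> tangent_to_boundary H A 1 (X 1)"
  proof -
    have "tangent_to_boundary H A q (X q)"
      if "1 \<notin> interior_points H A" "q \<in> boundary_points H A" for q
    proof (rule tangent_at_unit_imp_tangent_to_boundary[OF M inv _ _ _ that(2)])
      show "X 1 \<in> tangent_space H A 1" using X by (simp add: lipschitz_field_def)
      show "g * h \<in> boundary_points H A"
        if "g \<in> boundary_points H A" "h \<in> boundary_points H A" for g h
        using assms(2) \<open>1 \<notin> interior_points H A\<close> that by (simp add: normal_boundary_def)
      show "tangent_to_boundary H A 1 (X 1)" using * that(1) by blast
    qed
    then have "{0..} \<subseteq> path_domain A X g" "{..0} \<subseteq> path_domain A X g" for g
      using * tangent_to_boundary_uminus by (intro forward backward; blast)+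
    then have "path_domain A X g = UNIV" for g
      using linear[of 0 "_::real"] by fastforce
    then show ?thesis by (simp add: complete_field_def)
  qed
  have inward: "path_domain A X 1 = {0..} \<and> half_complete_field A X"
    if "inward_pointing H A 1 (X 1)"
    using path_domain_of_inward_pointing[of 1 X] forward that by (auto simp: half_complete_field_def)
  have outward: "path_domain A X 1 = {..0} \<and> half_complete_field A X"
    if "outward_pointing H A 1 (X 1)"
  proof -
    have N1: "inward_pointing H A 1 (?N 1)" using that by (simp add: inward_pointing_uminus)
    then have all: "{..0} \<subseteq> path_domain A X g" for g by (intro backward) blast
    have "{0..} \<subseteq> path_domain A ?N 1"
      using image_mono[OF all[of 1], of uminus] by (simp add: path_domain_uminus)
    from path_domain_of_inward_pointing[OF N1 this]
    have "uminus ` uminus ` path_domain A X 1 = uminus ` {0..}" by (simp add: path_domain_uminus)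
    then have "path_domain A X 1 = {..0}" by (simp add: image_image)
    then show ?thesis using all by (simp add: half_complete_field_def)
  qed
  have translate: "t \<in> path_domain A X g \<and> flow A X t g = g * flow A X t 1"
    if t: "t \<in> path_domain A X 1" for t g
  proof -
    obtain I \<gamma> where \<gamma>: "integral_path_on A X 1 I \<gamma>" "t \<in> I"
      using t by (auto simp: path_domain_def)
    note g\<gamma> = left_translate_of_path_from_unit[OF M inv \<gamma>(1), of g]
    have "flow A X t g = g * \<gamma> t" "flow A X t 1 = \<gamma> t"
      unfolding flow_def using integral_path_eq[OF X] g\<gamma> \<gamma> by blast+
    then show ?thesis using g\<gamma> \<gamma>(2) by (auto simp: path_domain_def)
  qed
  have flow: "flow A X t = right_translation (flow A X t 1)" if t: "t \<in> path_domain A X 1" for t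
  proof
    show "flow A X t g = right_translation (flow A X t 1) g" for g
      unfolding right_translation_def using translate[OF t] by (rule conjunct2)
  qed
  show ?thesis
  proof (intro conjI impI ballI allI)
    show "complete_field A X"
      if "1 \<in> interior_points H A \<or> 1 \<in> boundary_points H A \<and> tangent_to_boundary H A 1 (X 1)"
      using that by (rule complete)
    then show "tangent_to_boundary H A p (X p)"
      if "1 \<in> interior_points H A \<or> 1 \<in> boundary_points H A \<and> tangent_to_boundary H A 1 (X 1)"
        "p \<in> boundary_points H A" for p
      using that by (intro complete_imp_tangent_to_boundary)
    show "t \<in> path_domain A X g" if "t \<in> path_domain A X 1" for t g
      using translate[OF that] by (rule conjunct1)
    show "flow A X t = right_translation (flow A X t 1)" if "t \<in> path_domain A X 1" for t
      using that by (rule flow)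
  qed (use inward outward in blast)+
qed

end
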